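(* Let $p\in(1,\infty)$. For $b\in[0,1]$ let \[ R(p,b):=\big(b^{p-1}+(1-b)^{p-1}\big)\big(b^{\frac1{p-1}}+(1-b)^{\frac1{p-1}}\big)^{p-1}, \] and for $p\ne2$ let $b_p\in(0,\tfrac12)$ be the unique maximizer of $R(p,\cdot)$ over $[0,\tfrac12]$ (it exists and $\partial R(p,b)/\partial b>0$ on $(0,b_p)$, $<0$ on $(b_p,\tfrac12)$). For $b\in(0,1)$ let \[ t_b:=b-\frac{b^{1/(p-1)}}{b^{1/(p-1)}+(1-b)^{1/(p-1)}}. \] For $a,b\in(0,\infty)$ let $X_{a,b}$ denote a random variable with $\mathsf{P}(X_{a,b}=b)=\frac a{a+b}=1-\mathsf{P}(X_{a,b}=-a)$ (so $\mathsf{E}X_{a,b}=0$). Let $C_p$ denote the best (smallest) constant $C\in[0,\infty]$ such that $\mathsf{E}|X-\mathsf{E}X|^p\le C\,\mathsf{E}|X|^p$ for all real random variables $X$ with finite mean. Then: (i) $C_p=\sup_{b\in[0,1]}R(p,b)=\max_{b\in(0,1/2)}R(p,b)$, and for $p\ne2$ also $C_p=R(p,b_p)$; in particular $C_2=R(2,b)=1$ for all $b\in[0,1]$. Hence $\mathsf{E}|X-\mathsf{E}X|^p\le C_p\,\mathsf{E}|X|^p$ for every random variable $X$ with finite mean. (ii) For a random variable $X$ with finite mean, equality $\mathsf{E}|X-\mathsf{E}X|^p= C_p\,\mathsf{E}|X|^p$ holds if and only if one of the following holds: (a) $\mathsf{E}|X|^p=\infty$; (b) $p=2$, $\mathsf{E}X^2<\infty$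 and $\mathsf{E}X=0$; (c) $p\ne2$ and $X$ has the same distribution as $\lambda(X_{1-b_p,b_p}-t_{b_p})$ for some $\lambda\in\mathbb{R}$. (iii) If $q$ is defined by $\frac1p+\frac1q=1$, then $C_p^{1/\sqrt{p-1}}=C_q^{1/\sqrt{q-1}}$, and, for $p\ne2$, $b_p=b_q$. (iv) As $p\to\infty$, $C_p\sim \dfrac{2^p}{\sqrt{8ep}}$ (i.e. the ratio tends to $1$). (v) $C_p$ is strictly log-convex and hence continuous in $p\in(1,\infty)$; moreover $C_p$ decreases in $p\in(1,2]$ from $2$ to $1$ and increases in $p\in[2,\infty)$ from $1$ to $\infty$. (vi) Whenever $p$ is rational, the values $C_p$, $b_p$ and $t_{b_p}$ are algebraic numbers; in particular $C_3=\frac1{27}(17+7\sqrt7)=1.315\ldots$, $b_3=\frac12-\frac16\sqrt{1+2\sqrt7}=0.0819\ldots$, and $t_{b_3}=-\frac13\sqrt{\frac12(13\sqrt7-34)}=-0.148\ldots$.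
   Context: Equality in distribution of random variables means they have the same law. In (v), "decreases from $2$ to $1$" means $C_p\to2$ as $p\downarrow1$ and $C_2=1$; "increases from $1$ to $\infty$" means $C_p\to\infty$ as $p\to\infty$. *)

theory Defs
  imports "HOL-Probability.Probability" "HOL-Computational_Algebra.Polynomial"
begin

definition R :: "real \<Rightarrow> real \<Rightarrow> real" where
  "R p b = (b powr (p - 1) + (1 - b) powr (p - 1)) *
           (b powr (1 / (p - 1)) + (1 - b) powr (1 / (p - 1))) powr (p - 1)"

text \<open>b_p: the unique maximizer of R(p,.) over [0,1/2] (meaningful for p \<noteq> 2).\<close>
definition bp :: "real \<Rightarrow> real" where
  "bp p = (THE b. b \<in> {0..1/2} \<and> (\<forall>b'\<in>{0..1/2}. R p b' \<le> R p b))"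

definition tb :: "real \<Rightarrow> real \<Rightarrow> real" where
  "tb p b = b - b powr (1 / (p - 1)) / (b powr (1 / (p - 1)) + (1 - b) powr (1 / (p - 1)))"

definition Xab :: "real \<Rightarrow> real \<Rightarrow> real pmf" where
  "Xab a b = map_pmf (\<lambda>c. if c then b else - a) (bernoulli_pmf (a / (a + b)))"

definition Cp :: "real \<Rightarrow> ennreal" where
  "Cp p = Inf {C. \<forall>(M::real measure) (X::real \<Rightarrow> real).
      prob_space M \<and> X \<in> borel_measurable M \<and> integrable M X \<longrightarrow>
      (\<integral>\<^sup>+x. ennreal (\<bar>X x - (\<integral>y. X y \<partial>M)\<bar> powr p) \<partial>M)
        \<le> C * (\<integral>\<^sup>+x. ennreal (\<bar>X x\<bar> powr p) \<partial>M)}"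

definition Cr :: "real \<Rightarrow> real" where
  "Cr p = enn2real (Cp p)"

definition strictly_convex_on :: "real set \<Rightarrow> (real \<Rightarrow> real) \<Rightarrow> bool" where
  "strictly_convex_on S f \<longleftrightarrow> (\<forall>x\<in>S. \<forall>y\<in>S. \<forall>u. x \<noteq> y \<and> 0 < u \<and> u < 1 \<longrightarrow>
      f (u * x + (1 - u) * y) < u * f x + (1 - u) * f y)"

end

theory Submission
  imports Defs "HOL-Real_Asymp.Real_Asymp"
begin

text \<open>
  Put \<open>s = p - 1\<close>. For a two-point law of mean zero with weights \<open>1 - b\<close> and \<open>b\<close>, strict convexity of
  \<open>x\<^sup>p\<close> shows that \<open>R p b\<close> is the exact worst ratio of moments over all shifts, attained only at the shift
  \<open>tb p b\<close>. For a general \<open>X\<close> with mean \<open>1\<close> (by scaling), the two-point inequality says precisely that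
  there is a slope \<open>r\<close> with \<open>\<bar>x - 1\<bar>\<^sup>p \<le> C \<bar>x\<bar>\<^sup>p - r (x - 1)\<close> for all \<open>x\<close>; integrating gives the bound, and
  equality forces \<open>X\<close> to live on the contact set, which consists of two points.

  The substitution \<open>(1 - b) / b = e\<^bsup>2sz\<^esup>\<close> turns the sign of \<open>dR/db\<close> into that of
  \<open>N = sinh (\<alpha>z) - (s + 1) sinh (\<beta>z) - s sinh (\<gamma>z)\<close>, and \<open>N / sinh (\<beta>z)\<close> is increasing because
  \<open>N'' - \<beta>\<^sup>2 N > 0\<close>; hence the maximizer is unique. Log-convexity holds since
  \<open>ln R = \<psi>(s) + s \<psi>(1/s)\<close> with \<open>\<psi>\<close> convex, and \<open>R q = (R p)\<^bsup>1/s\<^esup>\<close> for conjugate exponents reduces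
  \<open>p \<down> 1\<close> to \<open>p \<rightarrow> \<infinity>\<close>, where the maximum sits near \<open>b = 1 / (2s)\<close>.
\<close>

section \<open>Algebraic real numbers form a field\<close>

text \<open>Scaling to mean 1 loses the variables of mean 0. For these C_p >= \<open>R p 0\<close> =
  1 gives the inequality, and for p other than 2 the strict bound C_p > 1 leaves only X = 0 in the
  equality case. A law on x < 1 < y with mean 1 is a multiple of X_{1-b,b} - t with b = (y - 1)/(y -
  x) and t = -1/(y - x). So the shift attached to a contact pair is always negative, and this
  separates b_p from its mirror image 1 - b_p, which maximizes R on [0,1] as well. A supremum of
  strictly convex functions need not be strictly convex. Here it is, because the maximum over b is
  attained: a strict supporting line of ln R at the maximizing b also supports ln C_p. The
  algebraicity claims about C_p and t_{b_p} combine b_p and 1 - b_p by sums, products, quotients and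
  rational powers; hence the linear algebra over the rationals that comes first.\<close>

interpretation rat_real: vector_space "\<lambda>(q::rat) (x::real). of_rat q * x"
  by unfold_locales (simp_all add: algebra_simps of_rat_add of_rat_mult)

lemma rat_real_span_mult:
  assumes "x \<in> rat_real.span S" "y \<in> rat_real.span T"
  shows "x * y \<in> rat_real.span ((\<lambda>(s, t). s * t) ` (S \<times> T))"
proof -
  let ?U = "rat_real.span ((\<lambda>(s, t). s * t) ` (S \<times> T))"
  have 1: "s * y \<in> ?U" if "s \<in> S" for s
    using assms(2)
  proof (induction rule: rat_real.span_induct_alt)
    case base
    then show ?case by (simp add: rat_real.span_zero)
  next
    case (step q t y)
    have "s * t \<in> ?U"
      using that step by (intro rat_real.span_base) auto
    then have "of_rat q * (s * t) + s * y \<in> ?U"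
      using step by (intro rat_real.span_add rat_real.span_scale)
    then show ?case by (simp add: algebra_simps)
  qed
  show ?thesis
    using assms(1)
  proof (induction rule: rat_real.span_induct_alt)
    case base
    then show ?case by (simp add: rat_real.span_zero)
  next
    case (step q s x)
    have "of_rat q * (s * y) + x * y \<in> ?U"
      using 1 step by (intro rat_real.span_add rat_real.span_scale) auto
    then show ?case by (simp add: algebra_simps)
  qed
qed

text \<open>Division by the leading coefficient expresses x^d through lower powers, and induction on
  k then brings every x^k down to 1, ..., x^(d-1).\<close>

lemma algebraic_imp_powers_in_finite_span:
  assumes "algebraic (x::real)"
  obtains S where "finite S" "\<And>k. x ^ k \<in> rat_real.span S"
proof -
  from assms obtain p where p: "\<And>i. coeff p i \<in> \<rat>" "p \<noteq> 0" "poly p x = 0"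
    using algebraic_altdef by blast
  define d where "d = degree p"
  define S where "S = (\<lambda>i. x ^ i) ` {..<d}"
  have d: "d > 0"
    using p(2,3) by (metis d_def degree_eq_zeroE gr0I mult_zero_right pCons_0_0 poly_0 poly_pCons add.right_neutral)
  have l: "coeff p d \<noteq> 0" using p d_def by auto
  have xd: "x ^ d = (\<Sum>i<d. - (coeff p i / coeff p d) * x ^ i)"
  proof -
    have "0 = (\<Sum>i\<le>d. coeff p i * x ^ i)" using p(3) by (simp add: poly_altdef d_def)
    also have "\<dots> = (\<Sum>i<d. coeff p i * x ^ i) + coeff p d * x ^ d"
      by (simp add: lessThan_Suc_atMost[symmetric])
    finally have "x ^ d = - (\<Sum>i<d. coeff p i * x ^ i) / coeff p d"
      using l by (simp add: field_simps)
    also have "\<dots> = (\<Sum>i<d. - (coeff p i / coeff p d) * x ^ i)"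
      by (simp add: sum_divide_distrib sum_negf)
    finally show ?thesis .
  qed
  have k: "x ^ k \<in> rat_real.span S" for k
  proof (induction k rule: less_induct)
    case (less k)
    show ?case
    proof (cases "k < d")
      case True
      then show ?thesis by (intro rat_real.span_base) (auto simp: S_def)
    next
      case False
      have "x ^ k = x ^ (k - d) * x ^ d"
        using False by (simp flip: power_add)
      also have "\<dots> = (\<Sum>i<d. - (coeff p i / coeff p d) * x ^ (k - d + i))"
        by (simp add: xd sum_distrib_left power_add algebra_simps)
      also have "\<dots> \<in> rat_real.span S"
      proof (rule rat_real.span_sum)
        fix i assume i: "i \<in> {..<d}"
        have "- (coeff p i / coeff p d) \<in> \<rat>" using p by auto
        then obtain q where q: "- (coeff p i / coeff p d) = of_rat q"
          by (metis Rats_cases)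
        show "- (coeff p i / coeff p d) * x ^ (k - d + i) \<in> rat_real.span S"
          unfolding q using False i by (intro rat_real.span_scale less) auto
      qed
      finally show ?thesis .
    qed
  qed
  show ?thesis
    using that[OF _ k] by (simp add: S_def)
qed

text \<open>Among the \<open>card S + 1\<close> first powers either two coincide or there are too
  many to be independent; both give a nonzero rational polynomial with root x. The criterion suits
  sums and products, since the products of two spanning sets serve for both.\<close>

lemma powers_in_finite_span_imp_algebraic:
  fixes x :: real
  assumes fin: "finite S" and span: "\<And>k. x ^ k \<in> rat_real.span S"
  shows "algebraic x"
proof (cases "inj_on (\<lambda>k. x ^ k) {..card S}")
  case False
  then obtain i j where ij: "i < j" "x ^ i = x ^ j"
    unfolding inj_on_def by (metis linorder_neqE_nat)
  let ?p = "monom 1 j - monom 1 i :: real poly"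
  have "coeff ?p j = 1" using ij by simp
  then have "?p \<noteq> 0" by (metis coeff_0 zero_neq_one)
  then show ?thesis
    using ij by (intro algebraicI'[of ?p]) (auto simp: poly_monom)
next
  case True
  let ?B = "(\<lambda>k. x ^ k) ` {..card S}"
  have "rat_real.dependent ?B"
  proof (rule ccontr)
    assume "\<not> rat_real.dependent ?B"
    from rat_real.independent_span_bound[OF fin this] span
    have "card ?B \<le> card S" by blast
    then show False using True by (simp add: card_image)
  qed
  then obtain u where u: "\<exists>v\<in>?B. u v \<noteq> 0" "(\<Sum>v\<in>?B. of_rat (u v) * v) = 0"
    by (subst (asm) rat_real.dependent_finite) auto
  define p where "p = (\<Sum>k\<le>card S. monom (of_rat (u (x ^ k)) :: real) k)"
  have cf: "coeff p i = (if i \<le> card S then of_rat (u (x ^ i)) else 0)" for i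
    by (simp add: p_def coeff_sum if_distrib sum.delta cong: if_cong)
  from u(1) obtain k where k: "k \<le> card S" "u (x ^ k) \<noteq> 0" by auto
  then have "coeff p k \<noteq> 0" by (simp add: cf)
  then have "p \<noteq> 0" by auto
  moreover have "poly p x = 0"
    using u(2) True by (simp add: p_def poly_sum poly_monom sum.reindex)
  ultimately show ?thesis
    by (intro algebraicI'[of p]) (auto simp: cf)
qed

lemma algebraic_real_mult [intro]:
  assumes "algebraic (x::real)" "algebraic y"
  shows "algebraic (x * y)"
proof -
  obtain S T where "finite S" "finite T" "\<And>k. x ^ k \<in> rat_real.span S" "\<And>k. y ^ k \<in> rat_real.span T"
    using assms algebraic_imp_powers_in_finite_span by metis
  then show ?thesis
    by (intro powers_in_finite_span_imp_algebraic[of "(\<lambda>(s, t). s * t) ` (S \<times> T)"])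
      (auto simp: power_mult_distrib intro: rat_real_span_mult)
qed

lemma algebraic_real_add [intro]:
  assumes "algebraic (x::real)" "algebraic y"
  shows "algebraic (x + y)"
proof -
  obtain S T where ST: "finite S" "finite T" "\<And>k. x ^ k \<in> rat_real.span S" "\<And>k. y ^ k \<in> rat_real.span T"
    using assms algebraic_imp_powers_in_finite_span by metis
  let ?U = "(\<lambda>(s, t). s * t) ` (S \<times> T)"
  have "(x + y) ^ k \<in> rat_real.span ?U" for k
  proof -
    have "(x + y) ^ k = (\<Sum>i\<le>k. of_rat (of_nat (k choose i)) * (x ^ i * y ^ (k - i)))"
      by (simp add: binomial_ring mult.assoc)
    also have "\<dots> \<in> rat_real.span ?U"
      by (intro rat_real.span_sum rat_real.span_scale rat_real_span_mult ST)
    finally show ?thesis .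
  qed
  then show ?thesis
    using ST by (intro powers_in_finite_span_imp_algebraic[of ?U]) auto
qed

lemma algebraic_real_diff [intro]:
  "algebraic (x::real) \<Longrightarrow> algebraic y \<Longrightarrow> algebraic (x - y)"
  using algebraic_real_add[of x "- y"] by auto

lemma algebraic_real_divide [intro]:
  "algebraic (x::real) \<Longrightarrow> algebraic y \<Longrightarrow> algebraic (x / y)"
  by (auto simp: divide_inverse)

lemma algebraic_real_power [intro]: "algebraic (x::real) \<Longrightarrow> algebraic (x ^ n)"
  by (induction n) auto

lemma algebraic_powr_rat:
  assumes "algebraic x" "x > 0" "(q::real) \<in> \<rat>" "q > 0"
  shows "algebraic (x powr q)"
proof -
  from assms obtain m n where mn: "n \<noteq> 0" "\<bar>q\<bar> = real m / real n"
    using Rats_abs_nat_div_natE by metis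
  then have "q = real m * (1 / real n)" using assms by simp
  then have "x powr q = (root n x) ^ m"
    using assms mn by (simp add: root_powr_inverse powr_powr mult.commute flip: powr_realpow)
  then show ?thesis using assms by auto
qed

section \<open>The maximizer of R\<close>

text \<open>The function N of the overview, with \<alpha> = s^2 + s - 1, \<beta> = s^2 - s + 1,
  \<gamma> = s^2 - s - 1: the frequencies that remain when products of powers of e^z, e^(sz) and
  e^(s^2 z) are multiplied out.\<close>

definition crit_fun :: "real \<Rightarrow> real \<Rightarrow> real" where
  "crit_fun s z = sinh ((s^2 + s - 1) * z) - (s + 1) * sinh ((s^2 - s + 1) * z) - s * sinh ((s^2 - s - 1) * z)"

definition crit_fun' :: "real \<Rightarrow> real \<Rightarrow> real" where
  "crit_fun' s z = (s^2 + s - 1) * cosh ((s^2 + s - 1) * z) - (s + 1) * (s^2 - s + 1) * cosh ((s^2 - s + 1) * z)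
     - s * (s^2 - s - 1) * cosh ((s^2 - s - 1) * z)"

lemma crit_fun_deriv: "(crit_fun s has_real_derivative crit_fun' s z) (at z)"
  unfolding crit_fun_def[abs_def] crit_fun'_def
  by (auto intro!: derivative_eq_intros)

text \<open>After \<beta>^2 N is split off, the two remaining coefficients agree: \<alpha>^2 -
  \<beta>^2 and -s(\<gamma>^2 - \<beta>^2) both equal 4 s^2 (s - 1). So the remainder is a multiple
  of sinh(\<alpha>z) + sinh(\<gamma>z), whose sign is easy to see.\<close>

lemma crit_fun'_deriv: "(crit_fun' s has_real_derivative
    ((s^2 - s + 1)^2 * crit_fun s z + 4 * s^2 * (s - 1) * (sinh ((s^2 + s - 1) * z) + sinh ((s^2 - s - 1) * z)))) (at z)"
proof -
  let ?a = "s^2 + s - 1" and ?b = "s^2 - s + 1" and ?g = "s^2 - s - 1"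
  have "(crit_fun' s has_real_derivative
     (?a^2 * sinh (?a * z) - (s + 1) * ?b^2 * sinh (?b * z) - s * ?g^2 * sinh (?g * z))) (at z)"
    unfolding crit_fun'_def[abs_def]
    by (auto intro!: derivative_eq_intros simp: power2_eq_square algebra_simps)
  moreover have "?a^2 * A - (s + 1) * ?b^2 * B - s * ?g^2 * C =
     ?b^2 * (A - (s + 1) * B - s * C) + 4 * s^2 * (s - 1) * (A + C)" for A B C :: real
    by algebra
  ultimately show ?thesis by (simp add: crit_fun_def)
qed

text \<open>The Wronskian of \<^term>\<open>crit_fun s\<close> and \<open>sinh (\<beta> z)\<close>; it is positive because
  \<open>N'' - \<beta>\<^sup>2 N\<close> is.\<close>
lemma crit_fun_wronskian_pos:
  assumes "s > 1" "z > 0"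
  shows "crit_fun' s z * sinh ((s^2 - s + 1) * z) - crit_fun s z * ((s^2 - s + 1) * cosh ((s^2 - s + 1) * z)) > 0"
proof -
  let ?b = "s^2 - s + 1"
  define W where "W = (\<lambda>z. crit_fun' s z * sinh (?b * z) - crit_fun s z * (?b * cosh (?b * z)))"
  define W' where "W' = (\<lambda>z. 4 * s^2 * (s - 1) * (sinh ((s^2 + s - 1) * z) + sinh ((s^2 - s - 1) * z)) * sinh (?b * z))"
  have b: "?b > 0" using assms by (smt (verit) less_1_mult power2_eq_square mult_less_cancel_left2 mult_le_cancel_left1)
  have D: "(W has_real_derivative W' z) (at z)" for z
    unfolding W_def W'_def
    by (rule derivative_eq_intros crit_fun_deriv crit_fun'_deriv refl | simp add: algebra_simps power2_eq_square)+
  have pos: "W' x > 0" if "x > 0" for x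
  proof -
    have "s^2 > 1" using assms by (simp add: one_less_power)
    \<comment> \<open>\<alpha> + \<gamma> = 2(s^2 - 1) > 0, so sinh(\<alpha>x) outweighs
      sinh(\<gamma>x) even where \<gamma> is negative.\<close>
    then have "- ((s^2 - s - 1) * x) < (s^2 + s - 1) * x"
      using that by (simp add: algebra_simps)
    then have "sinh (- ((s^2 - s - 1) * x)) < sinh ((s^2 + s - 1) * x)"
      by (simp only: sinh_real_less_iff)
    then have "sinh ((s^2 + s - 1) * x) + sinh ((s^2 - s - 1) * x) > 0" by simp
    then show ?thesis
      unfolding W'_def using assms b that by (intro mult_pos_pos) auto
  qed
  have "W 0 < W z"
    using DERIV_pos_imp_increasing_open[of 0 z W] D pos assms
    by (metis DERIV_isCont continuous_at_imp_continuous_on)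
  then show ?thesis by (simp add: W_def crit_fun_def)
qed

text \<open>N leaves 0 downwards, because N'(0) = -2(s - 1)^2 (s + 1), and the largest frequency
  \<alpha> wins in the end, so a zero exists. The increasing quotient \<open>Q\<close> has the sign
  of N, so there is only one.\<close>

lemma crit_fun_single_crossing:
  assumes "s > 1"
  obtains z0 where "z0 > 0" "\<And>z. 0 < z \<Longrightarrow> z < z0 \<Longrightarrow> crit_fun s z < 0" "\<And>z. z > z0 \<Longrightarrow> crit_fun s z > 0" "crit_fun s z0 = 0"
proof -
  let ?a = "s^2 + s - 1" and ?b = "s^2 - s + 1" and ?g = "s^2 - s - 1"
  have s2: "s^2 > s" using assms by (simp add: power2_eq_square)
  have b: "?b > 0" using s2 by simp
  define Q where "Q = (\<lambda>z. crit_fun s z / sinh (?b * z))"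
  have sh: "sinh (?b * z) > 0" if "z > 0" for z using b that by simp
  have D: "(Q has_real_derivative (crit_fun' s z * sinh (?b * z) - crit_fun s z * (?b * cosh (?b * z))) / (sinh (?b * z))^2) (at z)"
    if "z > 0" for z
    unfolding Q_def using sh[OF that]
    by (auto intro!: derivative_eq_intros crit_fun_deriv simp: power2_eq_square algebra_simps)
  have mono: "Q x < Q y" if "0 < x" "x < y" for x y
  proof (rule DERIV_pos_imp_increasing[OF that(2)])
    fix z assume "x \<le> z"
    with that have z: "z > 0" by linarith
    show "\<exists>D. (Q has_real_derivative D) (at z) \<and> D > 0"
      by (intro exI conjI, rule D[OF z]) (use crit_fun_wronskian_pos[OF assms z] sh[OF z] in \<open>intro divide_pos_pos zero_less_power\<close>)
  qed
  have neg: "\<exists>z>0. crit_fun s z < 0"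
  proof -
    have N0: "crit_fun s 0 = 0" by (simp add: crit_fun_def)
    have "crit_fun' s 0 = - 2 * (s - 1)^2 * (s + 1)" by (simp add: crit_fun'_def) algebra
    then have "crit_fun' s 0 < 0" using assms by (simp add: mult_pos_pos)
    from DERIV_neg_dec_right[OF crit_fun_deriv this] obtain d where
      d: "d > 0" "\<forall>h>0. h < d \<longrightarrow> crit_fun s 0 > crit_fun s (0 + h)" by auto
    then have "crit_fun s (d / 2) < 0" using N0 by (metis add_0 half_gt_zero field_sum_of_halves less_add_same_cancel1)
    then show ?thesis using d by (intro exI[of _ "d/2"]) auto
  qed
  then obtain z1 where z1: "z1 > 0" "crit_fun s z1 < 0" by blast
  have "\<exists>z>0. crit_fun s z > 0"
  proof -
    \<comment> \<open>The negative contributions sum to at most (s + 1) e^(\<beta>z), so a main term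
      above (2s + 1) e^(\<beta>z) leaves room.\<close>
    have "eventually (\<lambda>z::real. exp ((?a - ?b) * z) > 2 * (2 * s + 1)) at_top"
    proof -
      have "filterlim (\<lambda>z::real. exp ((?a - ?b) * z)) at_top at_top"
        using assms by (intro filterlim_compose[OF exp_at_top] filterlim_tendsto_pos_mult_at_top[OF tendsto_const _ filterlim_ident]) auto
      then show ?thesis by (simp add: filterlim_at_top_dense)
    qed
    moreover have "eventually (\<lambda>z::real. z > 1) at_top" by (rule eventually_gt_at_top)
    ultimately obtain z :: real where z: "exp ((?a - ?b) * z) > 2 * (2 * s + 1)" "z > 1"
      using eventually_happens[OF eventually_conj] by (metis (no_types, lifting) trivial_limit_at_top_linorder)
    have "exp (?a * z) = exp ((?a - ?b) * z) * exp (?b * z)"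
      by (simp flip: exp_add add: algebra_simps)
    then have 1: "exp (?a * z) > 2 * (2 * s + 1) * exp (?b * z)" using z by simp
    have "exp (?b * z) > 1" using b z by simp
    moreover have "exp (- (?a * z)) < 1" using s2 assms z by (simp add: mult_pos_pos)
    ultimately have 2: "sinh (?a * z) \<ge> 1/2 * exp (?a * z) - 1/2 * exp (?b * z)"
      by (simp add: sinh_def)
    have 3: "sinh (?b * z) \<le> 1/2 * exp (?b * z)" by (simp add: sinh_def)
    have "?g * z \<le> ?b * z" using z by simp
    then have "sinh (?g * z) \<le> sinh (?b * z)" by (simp only: sinh_real_le_iff)
    with 3 have "sinh (?g * z) \<le> 1/2 * exp (?b * z)" by linarith
    then have 4: "s * sinh (?g * z) \<le> s * (1/2 * exp (?b * z))"
      using assms by (intro mult_left_mono) auto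
    have 5: "(s + 1) * sinh (?b * z) \<le> (s + 1) * (1/2 * exp (?b * z))"
      using 3 assms by (intro mult_left_mono) auto
    have e: "1/2 * e + (s + 1) * (1/2 * e) + s * (1/2 * e) < (2 * s + 1) * e" if "e > 0" for e :: real
    proof -
      have "(2 * s + 1) * e - (1/2 * e + (s + 1) * (1/2 * e) + s * (1/2 * e)) = s * e" by algebra
      then show ?thesis using mult_pos_pos[of s e] that assms by linarith
    qed
    note 6 = e[OF exp_gt_zero[of "?b * z"]]
    have "crit_fun s z > 0" unfolding crit_fun_def using 1 2 4 5 6 by linarith
    then show ?thesis using z by (intro exI[of _ z]) auto
  qed
  then obtain z2 where z2: "z2 > 0" "crit_fun s z2 > 0" by blast
  have sgnQ: "Q z < 0 \<longleftrightarrow> crit_fun s z < 0" "Q z > 0 \<longleftrightarrow> crit_fun s z > 0" if "z > 0" for z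
    using sh[OF that] by (auto simp: Q_def divide_simps)
  have "z1 < z2"
  proof (rule ccontr)
    assume "\<not> z1 < z2"
    then have "z2 < z1 \<or> z2 = z1" by auto
    then show False using mono[of z2 z1] sgnQ z1 z2 by force
  qed
  have "\<exists>z\<ge>z1. z \<le> z2 \<and> crit_fun s z = 0"
    using z1 z2 \<open>z1 < z2\<close> crit_fun_deriv[THEN DERIV_isCont] by (intro IVT) auto
  then obtain z0 where z0: "z1 \<le> z0" "crit_fun s z0 = 0" by blast
  have p0: "z0 > 0" using z0 z1 by linarith
  have Q0: "Q z0 = 0" using z0 by (simp add: Q_def)
  show ?thesis
  proof (rule that[OF p0 _ _ z0(2)])
    show "crit_fun s z < 0" if "0 < z" "z < z0" for z
      using mono[OF that] Q0 sgnQ(1) that by simp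
    show "crit_fun s z > 0" if "z0 < z" for z
      using mono[OF p0 that] Q0 sgnQ(2)[of z] that p0 by simp
  qed
qed

text \<open>With \<open>b = e\<^bsup>m - sz\<^esup>\<close>, \<open>1 - b = e\<^bsup>m + sz\<^esup>\<close> the numerator of the logarithmic derivative of
  \<open>R\<close> is a multiple of \<^const>\<open>crit_fun\<close>.\<close>
definition R_num :: "real \<Rightarrow> real \<Rightarrow> real" where
  "R_num s b = s * (b powr s * (1 - b) - (1 - b) powr s * b) * (b powr (1 / s) + (1 - b) powr (1 / s))
     + (b powr (1 / s) * (1 - b) - (1 - b) powr (1 / s) * b) * (b powr s + (1 - b) powr s)"

lemma R_num_eq_crit_fun:
  assumes "s > 0" "0 < b" "b < 1"
  shows "R_num s b = 2 * exp ((s + 1 + 1 / s) * ((ln b + ln (1 - b)) / 2)) * crit_fun s ((ln (1 - b) - ln b) / (2 * s))"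
proof -
  define z where "z = (ln (1 - b) - ln b) / (2 * s)"
  define m where "m = (ln b + ln (1 - b)) / 2"
  have lb: "ln b = m - s * z" and lv: "ln (1 - b) = m + s * z"
    using assms by (simp_all add: z_def m_def field_simps)
  have b: "b = exp (m - s * z)" and v: "1 - b = exp (m + s * z)"
    using assms lb lv by (metis exp_ln, metis exp_ln diff_gt_0_iff_gt)
  \<comment> \<open>In these letters every power is a monomial: b = A/F, b^s = B/G, b^(1/s) = C/E,
    and for 1 - b the quotients become products. A, B and C factor out, and what is left expands
    into three hyperbolic sines.\<close>
  define E F G A B C where "E = exp z" and "F = exp (s * z)" and "G = exp (s * s * z)"
    and "A = exp m" and "B = exp (s * m)" and "C = exp (m / s)"
  have pos: "E > 0" "F > 0" "G > 0" "A > 0" "B > 0" "C > 0"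
    by (simp_all add: E_def F_def G_def A_def B_def C_def)
  have R: "R_num s b = s * (B / G * (A * F) - B * G * (A / F)) * (C / E + C * E)
      + (C / E * (A * F) - C * E * (A / F)) * (B / G + B * G)"
  proof -
    have 1: "b powr s = B / G"
      using assms by (simp add: powr_def lb B_def G_def right_diff_distrib exp_diff mult.assoc)
    have 2: "(1 - b) powr s = B * G"
      using assms by (simp add: powr_def lv B_def G_def ring_distribs exp_add mult.assoc)
    have 3: "b powr (1/s) = C / E"
      using assms by (simp add: powr_def lb C_def E_def diff_divide_distrib exp_diff)
    have 4: "(1 - b) powr (1/s) = C * E"
      using assms by (simp add: powr_def lv C_def E_def add_divide_distrib exp_add)
    have 5: "b = A / F" "1 - b = A * F"
      using b v by (simp_all add: A_def F_def exp_diff exp_add)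
    show ?thesis unfolding R_num_def 1 2 3 4 by (subst (2) 5(2), subst (1) 5(2)) (simp flip: 5)
  qed
  have "exp ((s^2 + s - 1) * z) = G * F / E" "exp ((s^2 - s + 1) * z) = G * E / F"
    "exp ((s^2 - s - 1) * z) = G / (F * E)"
    by (simp_all add: E_def F_def G_def power2_eq_square algebra_simps exp_add exp_diff)
  then have N: "crit_fun s z = (G * F / E - E / (G * F)) / 2 - (s + 1) * ((G * E / F - F / (G * E)) / 2)
      - s * ((G / (F * E) - F * E / G) / 2)"
    by (simp add: crit_fun_def sinh_field_def exp_minus)
  have P: "exp ((s + 1 + 1 / s) * m) = A * B * C"
    by (simp add: A_def B_def C_def ring_distribs exp_add)
  show ?thesis
    unfolding z_def[symmetric] m_def[symmetric] R N P using pos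
    by (simp add: field_simps)
qed

lemma R_num_sign_change_gt1:
  assumes "s > 1"
  shows "\<exists>b0. 0 < b0 \<and> b0 < 1/2 \<and> R_num s b0 = 0 \<and> (\<forall>b. 0 < b \<longrightarrow> b < b0 \<longrightarrow> R_num s b > 0) \<and>
    (\<forall>b. b0 < b \<longrightarrow> b < 1/2 \<longrightarrow> R_num s b < 0)"
proof -
  obtain z0 where z0: "z0 > 0" "\<And>z. 0 < z \<Longrightarrow> z < z0 \<Longrightarrow> crit_fun s z < 0"
    "\<And>z. z > z0 \<Longrightarrow> crit_fun s z > 0" "crit_fun s z0 = 0"
    using crit_fun_single_crossing[OF assms] by metis
  define z where "z = (\<lambda>b. (ln (1 - b) - ln b) / (2 * s))"
  \<comment> \<open>The substitution inverted at \<open>z0\<close>. As z decreases when b grows, the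
    sign pattern of \<open>crit_fun\<close> is reversed.\<close>
  define b0 where "b0 = 1 / (1 + exp (2 * s * z0))"
  have e1: "exp (2 * s * z0) > 1" using z0 assms by simp
  have b0: "0 < b0" "b0 < 1/2" using e1 by (simp_all add: b0_def field_simps add_pos_pos)
  have "1 + exp (2 * s * z0) \<noteq> 0" using e1 by linarith
  then have "1 - b0 = exp (2 * s * z0) * b0" by (simp add: b0_def divide_simps)
  then have "ln (1 - b0) = 2 * s * z0 + ln b0" using b0 by (simp add: ln_mult)
  then have zb0: "z b0 = z0" using assms by (simp add: z_def field_simps)
  have anti: "z y < z x" if "0 < x" "x < y" "y < 1" for x y
  proof -
    have "ln (1 - y) < ln (1 - x)" "ln x < ln y" using that by auto
    then show ?thesis unfolding z_def using assms by (intro divide_strict_right_mono) auto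
  qed
  have zpos: "z b > 0" if "0 < b" "b < 1/2" for b
  proof -
    have "ln b < ln (1 - b)" using that by auto
    then show ?thesis using assms by (simp add: z_def)
  qed
  have Rn: "R_num s b = 2 * exp ((s + 1 + 1 / s) * ((ln b + ln (1 - b)) / 2)) * crit_fun s (z b)"
    if "0 < b" "b < 1" for b
    using R_num_eq_crit_fun[OF _ that] assms by (simp add: z_def)
  show ?thesis
  proof (intro exI[of _ b0] conjI allI impI)
    show "R_num s b0 = 0" using Rn[of b0] b0 zb0 z0 by simp
    show "R_num s b > 0" if "0 < b" "b < b0" for b
      using Rn[of b] z0(3)[of "z b"] anti[of b b0] that b0 zb0 by simp
    show "R_num s b < 0" if "b0 < b" "b < 1/2" for b
      using Rn[of b] z0(2)[of "z b"] anti[of b0 b] zpos[of b] that b0 zb0 by (simp add: mult_pos_neg)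
  qed (use b0 in auto)
qed

text \<open>Replacing s by 1/s exchanges the two summands. This reduces s < 1 to s > 1, the range in
  which the Wronskian is positive.\<close>

lemma R_num_inverse: "s > 0 \<Longrightarrow> R_num (1 / s) b = R_num s b / s"
  by (simp add: R_num_def field_simps)

lemma R_num_sign_change:
  assumes "s > 0" "s \<noteq> 1"
  shows "\<exists>b0. 0 < b0 \<and> b0 < 1/2 \<and> R_num s b0 = 0 \<and> (\<forall>b. 0 < b \<longrightarrow> b < b0 \<longrightarrow> R_num s b > 0) \<and>
    (\<forall>b. b0 < b \<longrightarrow> b < 1/2 \<longrightarrow> R_num s b < 0)"
proof (cases "s > 1")
  case True
  then show ?thesis by (rule R_num_sign_change_gt1)
next
  case False
  then have s: "1 / s > 1" using assms by simp
  have "R_num s b = R_num (1 / s) b * s" for b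
    using R_num_inverse[of s b] assms by simp
  then show ?thesis
    using R_num_sign_change_gt1[OF s] assms by (simp add: zero_less_mult_iff mult_less_0_iff)
qed

lemma R_deriv:
  assumes "p > 1" "0 < b" "b < 1"
  shows "(R p has_real_derivative R p b * R_num (p - 1) b / (b * (1 - b) * (b powr (p - 1) + (1 - b) powr (p - 1))
      * (b powr (1 / (p - 1)) + (1 - b) powr (1 / (p - 1))))) (at b)"
proof -
  define s where "s = p - 1"
  define c where "c = 1 / s"
  have s: "s > 0" "c > 0" "s * c = 1" using assms by (simp_all add: s_def c_def)
  define f where "f = (\<lambda>b. b powr s + (1 - b) powr s)"
  define g where "g = (\<lambda>b. b powr c + (1 - b) powr c)"
  have Rfg: "R p = (\<lambda>b. f b * g b powr s)"
    by (auto simp: R_def f_def g_def s_def c_def)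
  have pos: "f b > 0" "g b > 0" using assms by (auto simp: f_def g_def add_pos_pos)
  have f: "(f has_real_derivative s * (b powr s / b - (1 - b) powr s / (1 - b))) (at b)"
    unfolding f_def using assms
    by (auto intro!: derivative_eq_intros simp: powr_diff algebra_simps)
  have g: "(g has_real_derivative c * (b powr c / b - (1 - b) powr c / (1 - b))) (at b)"
    unfolding g_def using assms
    by (auto intro!: derivative_eq_intros simp: powr_diff algebra_simps)
  have gs: "((\<lambda>b. g b powr s) has_real_derivative
      (s * c) * (b powr c / b - (1 - b) powr c / (1 - b)) * (g b powr s / g b)) (at b)"
    by (rule DERIV_cong[OF DERIV_powr[OF g pos(2) DERIV_const[of s]]])
      (use pos in \<open>simp add: powr_diff mult_ac\<close>)
  have D: "(R p has_real_derivative
      s * (b powr s / b - (1 - b) powr s / (1 - b)) * g b powr s +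
      (b powr c / b - (1 - b) powr c / (1 - b)) * (g b powr s / g b) * f b) (at b)"
    unfolding Rfg using DERIV_mult[OF f gs] s by simp
  have alg: "s * (U / u - V / v) * H + (X / u - Y / v) * (H / G) * F =
      F * H * (s * (U * v - V * u) * G + (X * v - Y * u) * F) / (u * v * F * G)"
    if "u > 0" "v > 0" "F > 0" "G > 0" for u v U V X Y F G H :: real
    using that by (simp add: field_simps)
  have v: "1 - b > 0" using assms by simp
  have eq: "s * (b powr s / b - (1 - b) powr s / (1 - b)) * g b powr s +
      (b powr c / b - (1 - b) powr c / (1 - b)) * (g b powr s / g b) * f b =
      R p b * R_num s b / (b * (1 - b) * f b * g b)"
    unfolding alg[OF assms(2) v pos] Rfg R_num_def
    by (simp add: f_def g_def c_def)
  show ?thesis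
    using D unfolding eq by (simp only: s_def c_def f_def g_def)
qed

section \<open>Elementary properties of \<open>R\<close> and its maximum on [0,1]\<close>

lemma powr_sum_pos: "0 \<le> b \<Longrightarrow> b \<le> 1 \<Longrightarrow> b powr x + (1 - b) powr x > (0::real)"
  by (cases "b = 0") (simp_all add: add_pos_nonneg)

lemma R_pos: "p > 1 \<Longrightarrow> 0 \<le> b \<Longrightarrow> b \<le> 1 \<Longrightarrow> R p b > 0"
  using powr_sum_pos[of b "p - 1"] powr_sum_pos[of b "1 / (p - 1)"] by (simp add: R_def)

lemma R_symmetric: "R p (1 - b) = R p b"
  by (simp add: R_def add.commute)

lemma R_0: "R p 0 = 1"
  by (simp add: R_def)

lemma R_2: "b \<in> {0..1} \<Longrightarrow> R 2 b = 1"
  by (simp add: R_def)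

lemma continuous_on_R:
  assumes "p > 1"
  shows "continuous_on {0..1} (R p)"
proof -
  have *: "continuous_on {0..1} (\<lambda>b::real. b powr x + (1 - b) powr x)" if "x > 0" for x :: real
    using that by (intro continuous_on_add continuous_on_powr' continuous_on_diff
        continuous_on_const continuous_on_id) auto
  have "continuous_on {0..1} (\<lambda>b. (b powr (1 / (p - 1)) + (1 - b) powr (1 / (p - 1))) powr (p - 1))"
  proof (rule continuous_on_powr'[OF * continuous_on_const])
    show "\<forall>b\<in>{0..1}. 0 \<le> b powr (1 / (p - 1)) + (1 - b) powr (1 / (p - 1)) \<and>
      (b powr (1 / (p - 1)) + (1 - b) powr (1 / (p - 1)) = 0 \<longrightarrow> 0 < p - 1)"
      using assms by (simp add: add_nonneg_nonneg)
  qed (use assms in auto)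
  with *[of "p - 1"] show ?thesis
    unfolding R_def[abs_def] using assms by (intro continuous_on_mult) auto
qed

text \<open>With q - 1 = 1/(p - 1) the two factors of R trade places, up to the outer power 1/(p -
  1).\<close>

lemma R_conjugate:
  assumes "p > 1" "q > 1" "(p - 1) * (q - 1) = 1" "0 \<le> b" "b \<le> 1"
  shows "R q b = R p b powr (1 / (p - 1))"
proof -
  have q: "q - 1 = 1 / (p - 1)" "1 / (q - 1) = p - 1" using assms by (simp_all add: field_simps)
  let ?f = "b powr (p - 1) + (1 - b) powr (p - 1)" and ?g = "b powr (1 / (p - 1)) + (1 - b) powr (1 / (p - 1))"
  have pos: "?f \<ge> 0" "?g > 0" using powr_sum_pos[OF assms(4,5)] by (simp_all add: less_imp_le)
  have "R p b powr (1 / (p - 1)) = ?f powr (1 / (p - 1)) * (?g powr (p - 1)) powr (1 / (p - 1))"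
    unfolding R_def using pos by (simp only: powr_mult powr_ge_zero)
  also have "(?g powr (p - 1)) powr (1 / (p - 1)) = ?g"
    using assms(1) pos(2) by (simp add: powr_powr)
  finally show ?thesis
    unfolding R_def q by simp
qed

text \<open>The last clause supplies points where \<open>R_num\<close> does not vanish; the
  algebraicity of b_p uses it to see that its polynomial is nonzero.\<close>

lemma ex_bp:
  assumes "p > 1" "p \<noteq> 2"
  obtains b0 where "0 < b0" "b0 < 1/2" "R_num (p - 1) b0 = 0"
    "\<And>b. 0 < b \<Longrightarrow> b < b0 \<Longrightarrow> \<exists>D. (R p has_real_derivative D) (at b) \<and> D > 0"
    "\<And>b. b0 < b \<Longrightarrow> b < 1/2 \<Longrightarrow> \<exists>D. (R p has_real_derivative D) (at b) \<and> D < 0"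
    "\<And>b. 0 < b \<Longrightarrow> b < b0 \<Longrightarrow> R_num (p - 1) b \<noteq> 0"
proof -
  obtain b0 where b0: "0 < b0" "b0 < 1/2" "R_num (p - 1) b0 = 0"
    "\<And>b. 0 < b \<Longrightarrow> b < b0 \<Longrightarrow> R_num (p - 1) b > 0"
    "\<And>b. b0 < b \<Longrightarrow> b < 1/2 \<Longrightarrow> R_num (p - 1) b < 0"
    using R_num_sign_change[of "p - 1"] assms by auto
  define K where "K = (\<lambda>b. R p b / (b * (1 - b) * (b powr (p - 1) + (1 - b) powr (p - 1))
      * (b powr (1 / (p - 1)) + (1 - b) powr (1 / (p - 1)))))"
  have K: "K b > 0" if "0 < b" "b < 1" for b
    unfolding K_def using that assms(1) R_pos[of p b]
    by (intro divide_pos_pos mult_pos_pos powr_sum_pos) auto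
  have D: "(R p has_real_derivative K b * R_num (p - 1) b) (at b)" if "0 < b" "b < 1" for b
    using R_deriv[OF assms(1) that] by (simp add: K_def)
  show ?thesis
  proof (rule that[OF b0(1-3)])
    show "\<exists>D. (R p has_real_derivative D) (at b) \<and> D > 0" if "0 < b" "b < b0" for b
    proof (intro exI conjI)
      show "(R p has_real_derivative K b * R_num (p - 1) b) (at b)" using that b0(2) by (intro D) auto
      show "K b * R_num (p - 1) b > 0" using that b0(2) b0(4)[of b] by (intro mult_pos_pos K) auto
    qed
    show "\<exists>D. (R p has_real_derivative D) (at b) \<and> D < 0" if "b0 < b" "b < 1/2" for b
    proof (intro exI conjI)
      show "(R p has_real_derivative K b * R_num (p - 1) b) (at b)" using that b0(1) by (intro D) auto
      show "K b * R_num (p - 1) b < 0" using that b0(1) b0(5)[of b] by (intro mult_pos_neg K) auto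
    qed
    show "R_num (p - 1) b \<noteq> 0" if "0 < b" "b < b0" for b
      using b0(4)[OF that] by simp
  qed
qed

lemma bp_properties:
  assumes "p > 1" "p \<noteq> 2"
  shows bp_pos: "0 < bp p" and bp_less_half: "bp p < 1/2"
    and bp_unique: "b \<in> {0..1/2} \<Longrightarrow> (\<forall>b'\<in>{0..1/2}. R p b' \<le> R p b) \<Longrightarrow> b = bp p"
    and R_less_bp: "b \<in> {0..1/2} \<Longrightarrow> b \<noteq> bp p \<Longrightarrow> R p b < R p (bp p)"
    and R_deriv_pos: "0 < b \<Longrightarrow> b < bp p \<Longrightarrow> \<exists>D. (R p has_real_derivative D) (at b) \<and> D > 0"
    and R_deriv_neg: "bp p < b \<Longrightarrow> b < 1/2 \<Longrightarrow> \<exists>D. (R p has_real_derivative D) (at b) \<and> D < 0"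
    and R_num_bp: "R_num (p - 1) (bp p) = 0"
    and R_num_less_bp: "0 < b \<Longrightarrow> b < bp p \<Longrightarrow> R_num (p - 1) b \<noteq> 0"
proof -
  obtain b0 where b0: "0 < b0" "b0 < 1/2" "R_num (p - 1) b0 = 0"
    "\<And>b. 0 < b \<Longrightarrow> b < b0 \<Longrightarrow> \<exists>D. (R p has_real_derivative D) (at b) \<and> D > 0"
    "\<And>b. b0 < b \<Longrightarrow> b < 1/2 \<Longrightarrow> \<exists>D. (R p has_real_derivative D) (at b) \<and> D < 0"
    "\<And>b. 0 < b \<Longrightarrow> b < b0 \<Longrightarrow> R_num (p - 1) b \<noteq> 0"
    using ex_bp[OF assms] by metis
  have less: "R p b < R p b0" if "b \<in> {0..1/2}" "b \<noteq> b0" for b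
  proof (cases "b < b0")
    case True
    show ?thesis
    proof (rule DERIV_pos_imp_increasing_open[OF True])
      show "\<exists>D. (R p has_real_derivative D) (at x) \<and> D > 0" if "b < x" "x < b0" for x
        using that \<open>b \<in> {0..1/2}\<close> by (intro b0(4)) auto
      show "continuous_on {b..b0} (R p)"
        by (rule continuous_on_subset[OF continuous_on_R[OF assms(1)]]) (use that b0 in auto)
    qed
  next
    case False
    then have "b0 < b" using that by simp
    then show ?thesis
    proof (rule DERIV_neg_imp_decreasing_open)
      show "\<exists>D. (R p has_real_derivative D) (at x) \<and> D < 0" if "b0 < x" "x < b" for x
        using that \<open>b \<in> {0..1/2}\<close> by (intro b0(5)) auto
      show "continuous_on {b0..b} (R p)"
        by (rule continuous_on_subset[OF continuous_on_R[OF assms(1)]]) (use that b0 in auto)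
    qed
  qed
  have uniq: "b = b0" if "b \<in> {0..1/2}" "\<forall>b'\<in>{0..1/2}. R p b' \<le> R p b" for b
    using less[OF that(1)] that(2)[rule_format, of b0] b0 by (cases "b = b0") auto
  have max: "R p b \<le> R p b0" if "b \<in> {0..1/2}" for b
    using less[OF that] by (cases "b = b0") auto
  have bp: "bp p = b0"
    unfolding bp_def
  proof (rule the_equality)
    show "b0 \<in> {0..1/2} \<and> (\<forall>b'\<in>{0..1/2}. R p b' \<le> R p b0)"
      using max b0(1,2) by simp
  qed (use uniq in blast)
  show "0 < bp p" "bp p < 1/2" "R_num (p - 1) (bp p) = 0"
    unfolding bp by (rule b0)+
  show "b \<in> {0..1/2} \<Longrightarrow> (\<forall>b'\<in>{0..1/2}. R p b' \<le> R p b) \<Longrightarrow> b = bp p"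
    unfolding bp by (rule uniq)
  show "b \<in> {0..1/2} \<Longrightarrow> b \<noteq> bp p \<Longrightarrow> R p b < R p (bp p)"
    unfolding bp by (rule less)
  show "0 < b \<Longrightarrow> b < bp p \<Longrightarrow> \<exists>D. (R p has_real_derivative D) (at b) \<and> D > 0"
    unfolding bp by (rule b0(4))
  show "bp p < b \<Longrightarrow> b < 1/2 \<Longrightarrow> \<exists>D. (R p has_real_derivative D) (at b) \<and> D < 0"
    unfolding bp by (rule b0(5))
  show "0 < b \<Longrightarrow> b < bp p \<Longrightarrow> R_num (p - 1) b \<noteq> 0"
    unfolding bp by (rule b0(6))
qed

lemma R_le_bp:
  assumes "p > 1" "p \<noteq> 2" "b \<in> {0..1}"
  shows "R p b \<le> R p (bp p)"
proof -
  have *: "R p b \<le> R p (bp p)" if "b \<in> {0..1/2}" for b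
    using R_less_bp[OF assms(1,2) that] by (cases "b = bp p") auto
  show ?thesis
    using *[of b] *[of "1 - b"] assms(3) R_symmetric[of p b] by (cases "b \<le> 1/2") auto
qed

lemma R_eq_bp_iff:
  assumes "p > 1" "p \<noteq> 2" "b \<in> {0..1}"
  shows "R p b = R p (bp p) \<longleftrightarrow> b = bp p \<or> b = 1 - bp p"
proof
  assume eq: "R p b = R p (bp p)"
  show "b = bp p \<or> b = 1 - bp p"
  proof (cases "b \<le> 1/2")
    case True
    then show ?thesis using R_less_bp[OF assms(1,2), of b] eq assms(3) by force
  next
    case False
    then show ?thesis
      using R_less_bp[OF assms(1,2), of "1 - b"] eq assms(3) R_symmetric[of p b] by force
  qed
qed (auto simp: R_symmetric)

lemma R_bp_gt_1: "p > 1 \<Longrightarrow> p \<noteq> 2 \<Longrightarrow> R p (bp p) > 1"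
  using R_less_bp[of p 0] bp_pos[of p] by (simp add: R_0)

text \<open>\<open>R q\<close> is an increasing function of \<open>R p\<close>, so the two have the
  same maximizer.\<close>

lemma bp_conjugate:
  assumes "p > 1" "q > 1" "(p - 1) * (q - 1) = 1" "p \<noteq> 2"
  shows "bp q = bp p"
proof -
  have q2: "q \<noteq> 2" using assms by auto
  have "R q b \<le> R q (bp p)" if "b \<in> {0..1/2}" for b
    using R_le_bp[OF assms(1,4), of b] that assms bp_pos[of p] bp_less_half[of p] R_pos[of p b]
    by (simp add: R_conjugate[of p q] powr_mono2)
  then show ?thesis
    using bp_unique[OF assms(2) q2, of "bp p"] bp_pos[of p] bp_less_half[of p] assms by force
qed

section \<open>The recentering inequality\<close>

lemma powr_gt_tangent_at_1:
  fixes x p :: real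
  assumes "p > 1" "x \<ge> 0" "x \<noteq> 1"
  shows "x powr p > 1 + p * (x - 1)"
proof -
  define f where "f = (\<lambda>x. x powr p - p * x)"
  have D: "(f has_real_derivative p * (x powr (p - 1) - 1)) (at x)" if "x > 0" for x
    unfolding f_def using that by (auto intro!: derivative_eq_intros simp: algebra_simps)
  have C: "continuous_on {0..} f"
    unfolding f_def using assms
    by (intro continuous_on_diff continuous_on_powr' continuous_on_mult continuous_on_const continuous_on_id) auto
  have "f 1 < f x"
  proof (cases "x < 1")
    case True
    show ?thesis
    proof (rule DERIV_neg_imp_decreasing_open[OF True])
      fix y assume y: "x < y" "y < 1"
      then have "y powr (p - 1) < 1" using assms powr_less_mono2[of "p - 1" y 1] by simp
      then show "\<exists>D. (f has_real_derivative D) (at y) \<and> D < 0"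
        using assms y D[of y] by (intro exI[of _ "p * (y powr (p - 1) - 1)"]) (auto intro: mult_pos_neg)
    qed (rule continuous_on_subset[OF C], use assms in auto)
  next
    case False
    then have "1 < x" using assms by simp
    then show ?thesis
    proof (rule DERIV_pos_imp_increasing_open)
      fix y assume y: "1 < y" "y < x"
      then have "y powr (p - 1) > 1" using assms by simp
      then show "\<exists>D. (f has_real_derivative D) (at y) \<and> D > 0"
        using assms y D[of y] by (intro exI[of _ "p * (y powr (p - 1) - 1)"]) auto
    qed (rule continuous_on_subset[OF C], auto)
  qed
  then show ?thesis by (simp add: f_def algebra_simps)
qed

text \<open>Jensen at the points x/w and y/(1 - w), whose weighted mean x + y is at least 1: add the
  tangents of u^p at u = 1. Equality puts both points at 1.\<close>

lemma weighted_powr_sum_ge_1: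
  fixes p w x y :: real
  assumes p: "p > 1" and w: "0 < w" "w < 1" and xy: "x \<ge> 0" "y \<ge> 0" "x + y \<ge> 1"
  shows "w * (x / w) powr p + (1 - w) * (y / (1 - w)) powr p \<ge> 1"
    and "w * (x / w) powr p + (1 - w) * (y / (1 - w)) powr p = 1 \<Longrightarrow> x = w \<and> y = 1 - w"
proof -
  have T: "u * (z / u) powr p \<ge> u + p * (z - u) \<and> (z \<noteq> u \<longrightarrow> u * (z / u) powr p > u + p * (z - u))"
    if "u > 0" "z \<ge> 0" for u z
  proof (cases "z = u")
    case False
    then have "(z / u) powr p > 1 + p * (z / u - 1)"
      using that p by (intro powr_gt_tangent_at_1) auto
    then have "u * (z / u) powr p > u * (1 + p * (z / u - 1))" using that by simp
    also have "u * (1 + p * (z / u - 1)) = u + p * (z - u)" using that by (simp add: field_simps)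
    finally show ?thesis by simp
  qed (use that in simp)
  note Tx = T[OF w(1) xy(1)] and Ty = T[of "1 - w", OF _ xy(2)]
  have "p * (x + y - 1) \<ge> 0" using p xy by simp
  moreover have "w + p * (x - w) + (1 - w + p * (y - (1 - w))) = 1 + p * (x + y - 1)"
    by (simp add: algebra_simps)
  ultimately show "w * (x / w) powr p + (1 - w) * (y / (1 - w)) powr p \<ge> 1"
    and "w * (x / w) powr p + (1 - w) * (y / (1 - w)) powr p = 1 \<Longrightarrow> x = w \<and> y = 1 - w"
    using Tx Ty w by (auto; linarith)+
qed

context
  fixes p b :: real
  assumes p: "p > 1" and b: "0 < b" "b < 1"
begin

private definition "S = b powr (1 / (p - 1)) + (1 - b) powr (1 / (p - 1))"
text \<open>The weight is fixed by w^(p-1) : (1 - w)^(p-1) = b : (1 - b). With it both terms of the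
  shifted moment get the common factor b(1 - b)/S^(p-1), and what remains is the sum bounded by
  \<open>weighted_powr_sum_ge_1\<close>.\<close>

private definition "w = b powr (1 / (p - 1)) / S"

private lemma S_pos: "S > 0"
  using b by (simp add: S_def powr_sum_pos)

private lemma w: "0 < w" "w < 1" "1 - w = (1 - b) powr (1 / (p - 1)) / S" "w powr (p - 1) = b / S powr (p - 1)"
   "(1 - w) powr (p - 1) = (1 - b) / S powr (p - 1)" "tb p b = b - w"
proof -
  show "0 < w" using S_pos b by (simp add: w_def)
  show 1: "1 - w = (1 - b) powr (1 / (p - 1)) / S" using S_pos by (simp add: w_def field_simps) (simp add: S_def)
  have "1 - w > 0" unfolding 1 using S_pos b by simp
  then show "w < 1" by simp
  show "w powr (p - 1) = b / S powr (p - 1)"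
    using p b S_pos by (simp add: w_def powr_divide powr_powr)
  show "(1 - w) powr (p - 1) = (1 - b) / S powr (p - 1)"
    unfolding 1 using p b S_pos by (simp add: powr_divide powr_powr)
  show "tb p b = b - w" by (simp add: tb_def w_def S_def)
qed

private lemma moment_eq:
  "(1 - b) * \<bar>b - t\<bar> powr p + b * \<bar>1 - b + t\<bar> powr p =
   b * (1 - b) / S powr (p - 1) * (w * (\<bar>b - t\<bar> / w) powr p + (1 - w) * (\<bar>1 - b + t\<bar> / (1 - w)) powr p)"
proof -
  have P: "u * (x / u) powr p = x powr p / u powr (p - 1)" if "u > 0" "x \<ge> 0" for u x :: real
    using that by (simp add: powr_divide powr_diff)
  have w': "1 - w > 0" using w(2) by simp
  show ?thesis
    unfolding P[OF w(1) abs_ge_zero] P[OF w' abs_ge_zero] w(4,5)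
    using b S_pos by (simp add: field_simps)
qed

text \<open>The triangle inequality gives |b - t| + |1 - b + t| >= 1, so the weighted sum in
  \<open>moment_eq\<close> is at least 1. The left side is the p-th absolute moment of X_{1-b,b},
  and S cancels against the second factor of R.\<close>

lemma two_point_moment_lower_bound:
  "(1 - b) * b powr p + b * (1 - b) powr p \<le> R p b * ((1 - b) * \<bar>b - t\<bar> powr p + b * \<bar>1 - b + t\<bar> powr p)"
  and two_point_moment_eq_imp:
  "(1 - b) * b powr p + b * (1 - b) powr p = R p b * ((1 - b) * \<bar>b - t\<bar> powr p + b * \<bar>1 - b + t\<bar> powr p)
    \<Longrightarrow> t = tb p b"
  and two_point_moment_eq:
  "(1 - b) * b powr p + b * (1 - b) powr p =
    R p b * ((1 - b) * \<bar>b - tb p b\<bar> powr p + b * \<bar>1 - b + tb p b\<bar> powr p)"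
proof -
  let ?Q = "\<lambda>t. w * (\<bar>b - t\<bar> / w) powr p + (1 - w) * (\<bar>1 - b + t\<bar> / (1 - w)) powr p"
  define L where "L = (1 - b) * b powr p + b * (1 - b) powr p"
  have L: "L = b * (1 - b) * (b powr (p - 1) + (1 - b) powr (p - 1))"
    using b by (simp add: L_def powr_diff field_simps)
  have Lpos: "L > 0" unfolding L using b by (intro mult_pos_pos powr_sum_pos) auto
  have "R p b * (b * (1 - b) / S powr (p - 1)) = L"
    unfolding L R_def S_def[symmetric] using S_pos by simp
  then have R: "R p b * ((1 - b) * \<bar>b - t\<bar> powr p + b * \<bar>1 - b + t\<bar> powr p) = L * ?Q t" for t
    unfolding moment_eq by (metis mult.assoc)
  note W = weighted_powr_sum_ge_1[OF p w(1,2) abs_ge_zero abs_ge_zero, of "b - t" "1 - b + t" for t]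
  have "\<bar>b - t\<bar> + \<bar>1 - b + t\<bar> \<ge> 1" for t by arith
  note W = W[OF this]
  show "(1 - b) * b powr p + b * (1 - b) powr p \<le> R p b * ((1 - b) * \<bar>b - t\<bar> powr p + b * \<bar>1 - b + t\<bar> powr p)"
    unfolding R L_def[symmetric] using W(1)[of t] Lpos by simp
  show "t = tb p b" if "(1 - b) * b powr p + b * (1 - b) powr p =
      R p b * ((1 - b) * \<bar>b - t\<bar> powr p + b * \<bar>1 - b + t\<bar> powr p)"
  proof -
    have "?Q t = 1" using that Lpos unfolding R L_def[symmetric] by simp
    \<comment> \<open>Here |b - t| = w and |1 - b + t| = 1 - w. The sign b - t = -w would turn the
      second value into 1 + w, hence t = b - w.\<close>
    from W(2)[OF this] show ?thesis unfolding w(6) using w by (auto simp: abs_if split: if_splits)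
  qed
  show "(1 - b) * b powr p + b * (1 - b) powr p =
    R p b * ((1 - b) * \<bar>b - tb p b\<bar> powr p + b * \<bar>1 - b + tb p b\<bar> powr p)"
    unfolding R L_def[symmetric] w(6) using w(1,2) by simp
qed

end

lemma tb_symmetric:
  assumes "0 < b" "b < 1"
  shows "tb p (1 - b) = - tb p b"
proof -
  let ?u = "b powr (1 / (p - 1))" and ?v = "(1 - b) powr (1 / (p - 1))"
  have "?u + ?v > 0" using assms by (simp add: powr_sum_pos)
  then have "?u / (?u + ?v) + ?v / (?u + ?v) = 1" by (simp flip: add_divide_distrib)
  then show ?thesis by (simp add: tb_def add.commute)
qed

text \<open>Up to the factor 1/(y - x) these are the moments of the law on {x, y} with mean 1, which
  is l(X_{1-b,b} - t) for l = y - x, b = (y - 1)/l and t = -1/l. The weights are left unnormalized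
  so that difference quotients can be read off.\<close>

lemma two_point_recentering:
  fixes x y p K :: real
  assumes p: "p > 1" and K: "\<And>b. 0 < b \<Longrightarrow> b < 1 \<Longrightarrow> R p b \<le> K" and xy: "x < 1" "1 < y"
  shows "(y - 1) * \<bar>x - 1\<bar> powr p + (1 - x) * \<bar>y - 1\<bar> powr p \<le>
      K * ((y - 1) * \<bar>x\<bar> powr p + (1 - x) * \<bar>y\<bar> powr p)"
    and "(y - 1) * \<bar>x - 1\<bar> powr p + (1 - x) * \<bar>y - 1\<bar> powr p =
      K * ((y - 1) * \<bar>x\<bar> powr p + (1 - x) * \<bar>y\<bar> powr p) \<Longrightarrow>
      R p ((y - 1) / (y - x)) = K \<and> tb p ((y - 1) / (y - x)) = - 1 / (y - x)"
proof -
  define l where "l = y - x"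
  define b where "b = (y - 1) / l"
  define t where "t = - 1 / l"
  have l: "l > 0" using xy by (simp add: l_def)
  have b: "0 < b" "b < 1" using xy by (simp_all add: b_def l_def)
  have lbt: "l * b = y - 1" "l * t = - 1" using l by (simp_all add: b_def t_def)
  have e: "y - 1 = l * b" "1 - x = l * (1 - b)" "y = l * (b - t)" "x = - (l * (1 - b + t))"
    by (simp_all add: right_diff_distrib distrib_left lbt) (simp_all add: l_def)
  have ax: "\<bar>x - 1\<bar> = l * (1 - b)" "\<bar>y - 1\<bar> = l * b" using e xy by auto
  have ay: "\<bar>x\<bar> = l * \<bar>1 - b + t\<bar>" "\<bar>y\<bar> = l * \<bar>b - t\<bar>"
    by (subst e, use l in \<open>simp add: abs_mult\<close>)+
  define F where "F = (1 - b) * \<bar>b - t\<bar> powr p + b * \<bar>1 - b + t\<bar> powr p"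
  define G where "G = (1 - b) * b powr p + b * (1 - b) powr p"
  have A: "(y - 1) * \<bar>x - 1\<bar> powr p + (1 - x) * \<bar>y - 1\<bar> powr p = l * l powr p * G"
    unfolding ax e(1,2) G_def using l b by (simp add: powr_mult) (simp add: algebra_simps)
  have B: "(y - 1) * \<bar>x\<bar> powr p + (1 - x) * \<bar>y\<bar> powr p = l * l powr p * F"
    unfolding ay e(1,2) F_def using l b by (simp add: powr_mult) (simp add: algebra_simps)
  have lp: "l * l powr p > 0" using l by simp
  have GR: "G \<le> R p b * F"
    unfolding F_def G_def by (rule two_point_moment_lower_bound[OF p b])
  have "G > 0" unfolding G_def using b by (intro add_pos_pos) auto
  moreover have "R p b > 0" using R_pos[OF p, of b] b by simp
  ultimately have F: "F > 0" using GR by (smt (verit) mult_nonneg_nonpos)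
  have RK: "R p b * F \<le> K * F" using K[OF b] F by simp
  show "(y - 1) * \<bar>x - 1\<bar> powr p + (1 - x) * \<bar>y - 1\<bar> powr p \<le>
      K * ((y - 1) * \<bar>x\<bar> powr p + (1 - x) * \<bar>y\<bar> powr p)"
    unfolding A B using mult_left_mono[OF order_trans[OF GR RK] less_imp_le[OF lp]]
    by (simp only: mult.left_commute[of K])
  assume "(y - 1) * \<bar>x - 1\<bar> powr p + (1 - x) * \<bar>y - 1\<bar> powr p =
      K * ((y - 1) * \<bar>x\<bar> powr p + (1 - x) * \<bar>y\<bar> powr p)"
  then have "l * l powr p * G = l * l powr p * (K * F)" unfolding A B by (simp only: mult.left_commute[of K])
  then have "G = K * F" using l by simp
  with GR RK have "G = R p b * F" "R p b = K" using F by auto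
  then show "R p ((y - 1) / (y - x)) = K \<and> tb p ((y - 1) / (y - x)) = - 1 / (y - x)"
    using two_point_moment_eq_imp[OF p b, of t] by (simp add: F_def G_def b_def l_def t_def)
qed

text \<open>A separating slope exists because the two-point inequality orders the difference quotients
  at \<open>1\<close> from the left and from the right.\<close>
lemma ex_recentering_slope:
  fixes p K :: real
  assumes p: "p > 1" and K: "\<And>b. 0 < b \<Longrightarrow> b < 1 \<Longrightarrow> R p b \<le> K"
  obtains r where "\<And>x. \<bar>x - 1\<bar> powr p \<le> K * \<bar>x\<bar> powr p - r * (x - 1)"
proof -
  define f where "f = (\<lambda>x. K * \<bar>x\<bar> powr p - \<bar>x - 1\<bar> powr p)"
  define q where "q = (\<lambda>x. f x / (x - 1))"
  have le: "q x \<le> q y" if "x < 1" "1 < y" for x y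
  proof -
    have "(y - 1) * f x + (1 - x) * f y \<ge> 0"
      using two_point_recentering(1)[OF p K that] by (simp add: f_def algebra_simps)
    then show ?thesis using that by (simp add: q_def divide_simps) (simp add: algebra_simps)
  qed
  define r where "r = (SUP x\<in>{..<1}. q x)"
  \<comment> \<open>Any quotient from the right of 1 bounds all those from the left; the point 2 is
    arbitrary.\<close>
  have bdd: "bdd_above (q ` {..<1})" using le[of _ 2] by (auto intro!: bdd_aboveI[of _ "q 2"])
  have 1: "q x \<le> r" if "x < 1" for x
    unfolding r_def using that bdd by (intro cSUP_upper) auto
  have 2: "r \<le> q y" if "1 < y" for y
    unfolding r_def using le that by (intro cSUP_least) (auto intro: exI[of _ 0])
  have K0: "K > 0" using K[of "1/2"] R_pos[OF p, of "1/2"] by simp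
  have "\<bar>x - 1\<bar> powr p \<le> K * \<bar>x\<bar> powr p - r * (x - 1)" for x
  proof -
    consider "x < 1" | "x = 1" | "x > 1" by linarith
    then have "r * (x - 1) \<le> f x"
    proof cases
      case 1
      then show ?thesis using \<open>x < 1 \<Longrightarrow> q x \<le> r\<close> by (simp add: q_def divide_simps split: if_splits)
    next
      case 2
      then show ?thesis using K0 by (simp add: f_def)
    next
      case 3
      then show ?thesis using 2[of x] by (simp add: q_def pos_le_divide_eq)
    qed
    then show ?thesis by (simp add: f_def)
  qed
  then show ?thesis by (rule that)
qed

section \<open>Moments of two-point laws, the inequality for general X, and the value of
  \<open>Cp\<close>\<close>

lemma nn_integral_Xab:
  assumes "0 < b" "b < 1"
  shows "(\<integral>\<^sup>+x. f x \<partial>measure_pmf (Xab (1 - b) b)) = f b * ennreal (1 - b) + f (- (1 - b)) * ennreal b"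
  using assms by (simp add: Xab_def nn_integral_map_pmf nn_integral_bernoulli_pmf)

lemma nn_integral_Xab_real:
  fixes f :: "real \<Rightarrow> real"
  assumes "0 < b" "b < 1" "\<And>x. f x \<ge> 0"
  shows "(\<integral>\<^sup>+x. ennreal (f x) \<partial>measure_pmf (Xab (1 - b) b)) = ennreal ((1 - b) * f b + b * f (- (1 - b)))"
  using assms by (simp add: nn_integral_Xab ennreal_mult ennreal_plus mult.commute)

lemma integral_Xab:
  fixes f :: "real \<Rightarrow> real"
  assumes "0 < b" "b < 1"
  shows "(\<integral>x. f x \<partial>measure_pmf (Xab (1 - b) b)) = f b * (1 - b) + f (- (1 - b)) * b"
    and "integrable (measure_pmf (Xab (1 - b) b)) f"
  using assms by (auto intro!: integrable_measure_pmf_finite simp: Xab_def integral_map_pmf integral_bernoulli_pmf)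

lemma powr_moment_integrable:
  fixes X :: "'a \<Rightarrow> real" and p a :: real
  assumes "prob_space M" "X \<in> borel_measurable M" "p > 1" "(\<integral>\<^sup>+x. ennreal (\<bar>X x\<bar> powr p) \<partial>M) \<noteq> \<infinity>"
  shows "integrable M (\<lambda>x. \<bar>X x\<bar> powr p)" "integrable M (\<lambda>x. \<bar>X x - a\<bar> powr p)"
proof -
  interpret prob_space M by fact
  note [measurable] = assms(2)
  show 1: "integrable M (\<lambda>x. \<bar>X x\<bar> powr p)"
    using assms(4) by (intro integrableI_nonneg) (auto simp: top.not_eq_extremum)
  have bd: "\<bar>x - a\<bar> powr p \<le> 2 powr p * (\<bar>x\<bar> powr p + \<bar>a\<bar> powr p)" for x
  proof -
    have "\<bar>x - a\<bar> powr p \<le> (2 * max \<bar>x\<bar> \<bar>a\<bar>) powr p"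
      using assms(3) by (intro powr_mono2) auto
    also have "\<dots> = 2 powr p * max \<bar>x\<bar> \<bar>a\<bar> powr p" by (simp add: powr_mult)
    also have "\<dots> \<le> 2 powr p * (\<bar>x\<bar> powr p + \<bar>a\<bar> powr p)"
      by (intro mult_left_mono) (auto simp: max_def)
    finally show ?thesis .
  qed
  show "integrable M (\<lambda>x. \<bar>X x - a\<bar> powr p)"
    by (rule Bochner_Integration.integrable_bound[of M "\<lambda>x. 2 powr p * (\<bar>X x\<bar> powr p + \<bar>a\<bar> powr p)"])
      (use 1 bd in \<open>auto intro!: AE_I2 order_trans[OF bd]\<close>)
qed

text \<open>The slope of \<open>ex_recentering_slope\<close> multiplies a term of mean zero.\<close>
lemma recentering_real:
  fixes X :: "'a \<Rightarrow> real" and p K r :: real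
  assumes M: "prob_space M" and X: "X \<in> borel_measurable M" "integrable M X" and p: "p > 1"
    and fin: "(\<integral>\<^sup>+x. ennreal (\<bar>X x\<bar> powr p) \<partial>M) \<noteq> \<infinity>"
    and r: "\<And>x. \<bar>x - 1\<bar> powr p \<le> K * \<bar>x\<bar> powr p - r * (x - 1)"
    and m: "m = (\<integral>y. X y \<partial>M)" "m \<noteq> 0"
  shows "(\<integral>x. \<bar>X x - m\<bar> powr p \<partial>M) \<le> K * (\<integral>x. \<bar>X x\<bar> powr p \<partial>M)"
    and "(\<integral>x. \<bar>X x - m\<bar> powr p \<partial>M) = K * (\<integral>x. \<bar>X x\<bar> powr p \<partial>M) \<Longrightarrow>
      AE x in M. \<bar>X x / m - 1\<bar> powr p = K * \<bar>X x / m\<bar> powr p - r * (X x / m - 1)"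
proof -
  interpret prob_space M by fact
  note I = powr_moment_integrable(1)[OF M X(1) p fin] powr_moment_integrable(2)[OF M X(1) p fin, of m]
  \<comment> \<open>The slack of the pointwise inequality at X/m. The factor |m|^p uses homogeneity
    to return to moments of X itself.\<close>
  define g where "g = (\<lambda>x. \<bar>m\<bar> powr p * (K * \<bar>X x / m\<bar> powr p - r * (X x / m - 1) - \<bar>X x / m - 1\<bar> powr p))"
  have g: "g x = K * \<bar>X x\<bar> powr p - \<bar>m\<bar> powr p * r / m * (X x - m) - \<bar>X x - m\<bar> powr p" for x
  proof -
    have "X x / m - 1 = (X x - m) / m" using m by (simp add: field_simps)
    then have 1: "\<bar>m\<bar> powr p * \<bar>X x / m - 1\<bar> powr p = \<bar>X x - m\<bar> powr p"
      "\<bar>m\<bar> powr p * (r * (X x / m - 1)) = \<bar>m\<bar> powr p * r / m * (X x - m)"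
      using m by (simp_all add: abs_divide flip: powr_mult)
    have 2: "\<bar>m\<bar> powr p * (K * \<bar>X x / m\<bar> powr p) = K * \<bar>X x\<bar> powr p"
      using m by (simp add: abs_divide powr_divide)
    show ?thesis unfolding g_def right_diff_distrib[of "\<bar>m\<bar> powr p"] 1 2 ..
  qed
  have g0: "g x \<ge> 0" for x unfolding g_def using r[of "X x / m"] by (intro mult_nonneg_nonneg) auto
  have int: "integrable M g" unfolding g using I X by auto
  have E0: "(\<integral>x. X x - m \<partial>M) = 0" using X m by (simp add: prob_space)
  have E: "(\<integral>x. g x \<partial>M) = K * (\<integral>x. \<bar>X x\<bar> powr p \<partial>M) - (\<integral>x. \<bar>X x - m\<bar> powr p \<partial>M)"
  proof -
    have 1: "integrable M (\<lambda>x. K * \<bar>X x\<bar> powr p)" using I by simp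
    have 2: "integrable M (\<lambda>x. \<bar>m\<bar> powr p * r / m * (X x - m))" using X by simp
    have "(\<integral>x. g x \<partial>M) = (\<integral>x. K * \<bar>X x\<bar> powr p \<partial>M) - (\<integral>x. \<bar>m\<bar> powr p * r / m * (X x - m) \<partial>M)
        - (\<integral>x. \<bar>X x - m\<bar> powr p \<partial>M)"
      unfolding g
      by (simp only: Bochner_Integration.integral_diff[OF Bochner_Integration.integrable_diff[OF 1 2] I(2)]
          Bochner_Integration.integral_diff[OF 1 2])
    also have "(\<integral>x. \<bar>m\<bar> powr p * r / m * (X x - m) \<partial>M) = 0"
      by (simp only: integral_mult_right_zero E0)
    finally show ?thesis by simp
  qed
  have "(\<integral>x. g x \<partial>M) \<ge> 0" using g0 by (intro Bochner_Integration.integral_nonneg) auto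
  then show "(\<integral>x. \<bar>X x - m\<bar> powr p \<partial>M) \<le> K * (\<integral>x. \<bar>X x\<bar> powr p \<partial>M)" using E by simp
  assume "(\<integral>x. \<bar>X x - m\<bar> powr p \<partial>M) = K * (\<integral>x. \<bar>X x\<bar> powr p \<partial>M)"
  then have "AE x in M. g x = 0"
    using E int g0 integral_nonneg_eq_0_iff_AE[of M g] by simp
  then show "AE x in M. \<bar>X x / m - 1\<bar> powr p = K * \<bar>X x / m\<bar> powr p - r * (X x / m - 1)"
    by eventually_elim (use m in \<open>simp add: g_def\<close>)
qed

text \<open>For \<open>p = 2\<close> the function \<open>R p\<close> is constant, so any point of \<open>(0, 1/2)\<close> would do.\<close>
definition bmax :: "real \<Rightarrow> real" where
  "bmax p = (if p = 2 then 1/4 else bp p)"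

lemma bmax_bounds: "p > 1 \<Longrightarrow> 0 < bmax p" "p > 1 \<Longrightarrow> bmax p < 1/2"
  using bp_pos[of p] bp_less_half[of p] by (auto simp: bmax_def)

lemma R_le_bmax: "p > 1 \<Longrightarrow> b \<in> {0..1} \<Longrightarrow> R p b \<le> R p (bmax p)"
  by (cases "p = 2") (auto simp: bmax_def R_2 R_le_bp)

lemma R_bmax_ge_1: "p > 1 \<Longrightarrow> R p (bmax p) \<ge> 1"
  using R_le_bmax[of p 0] by (simp add: R_0)

lemma nn_integral_eq_moment:
  fixes X :: "'a \<Rightarrow> real" and p a :: real
  assumes "prob_space M" "X \<in> borel_measurable M" "p > 1" "(\<integral>\<^sup>+x. ennreal (\<bar>X x\<bar> powr p) \<partial>M) \<noteq> \<infinity>"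
  shows "(\<integral>\<^sup>+x. ennreal (\<bar>X x\<bar> powr p) \<partial>M) = ennreal (\<integral>x. \<bar>X x\<bar> powr p \<partial>M)"
    and "(\<integral>\<^sup>+x. ennreal (\<bar>X x - a\<bar> powr p) \<partial>M) = ennreal (\<integral>x. \<bar>X x - a\<bar> powr p \<partial>M)"
  using powr_moment_integrable[OF assms] by (auto intro!: nn_integral_eq_integral)

text \<open>Two cases escape the scaling to mean 1: an infinite moment makes the right side
  infinite, and for mean zero a constant of at least 1 suffices.\<close>

lemma recentering_inequality:
  fixes X :: "'a \<Rightarrow> real"
  assumes M: "prob_space M" and X: "X \<in> borel_measurable M" "integrable M X" and p: "p > 1"
  shows "(\<integral>\<^sup>+x. ennreal (\<bar>X x - (\<integral>y. X y \<partial>M)\<bar> powr p) \<partial>M)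
      \<le> ennreal (R p (bmax p)) * (\<integral>\<^sup>+x. ennreal (\<bar>X x\<bar> powr p) \<partial>M)"
proof (cases "(\<integral>\<^sup>+x. ennreal (\<bar>X x\<bar> powr p) \<partial>M) = \<infinity>")
  case True
  then show ?thesis using R_bmax_ge_1[OF p] by (simp add: ennreal_mult_top)
next
  case False
  let ?K = "R p (bmax p)" and ?m = "\<integral>y. X y \<partial>M"
  have K: "R p b \<le> ?K" if "0 < b" "b < 1" for b using R_le_bmax[OF p, of b] that by simp
  have nn: "(\<integral>x. \<bar>X x\<bar> powr p \<partial>M) \<ge> 0" by (intro Bochner_Integration.integral_nonneg) auto
  have "(\<integral>x. \<bar>X x - ?m\<bar> powr p \<partial>M) \<le> ?K * (\<integral>x. \<bar>X x\<bar> powr p \<partial>M)"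
  proof (cases "?m = 0")
    case True
    then show ?thesis using nn mult_right_mono[OF R_bmax_ge_1[OF p] nn] by simp
  next
    case m: False
    obtain r where r: "\<And>x. \<bar>x - 1\<bar> powr p \<le> ?K * \<bar>x\<bar> powr p - r * (x - 1)"
      using ex_recentering_slope[OF p K] by blast
    show ?thesis by (rule recentering_real(1)[OF M X p False r refl m])
  qed
  then show ?thesis
    using R_bmax_ge_1[OF p] nn
    by (simp add: nn_integral_eq_moment[OF M X(1) p False] flip: ennreal_mult)
qed

text \<open>The shift \<open>tb p b\<close> attains the ratio \<open>R p b\<close>. A finite and
  nonzero moment is what allows it to be cancelled in the lower bound for \<open>Cp\<close>.\<close>

lemma Xab_moments:
  assumes p: "p > 1" and b: "0 < b" "b < 1"
  shows "(\<integral>\<^sup>+x. ennreal (\<bar>c * (x - tb p b) - (\<integral>y. c * (y - tb p b) \<partial>measure_pmf (Xab (1 - b) b))\<bar> powr p)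
        \<partial>measure_pmf (Xab (1 - b) b)) =
      ennreal (R p b) * (\<integral>\<^sup>+x. ennreal (\<bar>c * (x - tb p b)\<bar> powr p) \<partial>measure_pmf (Xab (1 - b) b))"
    and "(\<integral>\<^sup>+x. ennreal (\<bar>c * (x - tb p b)\<bar> powr p) \<partial>measure_pmf (Xab (1 - b) b)) \<noteq> \<infinity>"
    and "c \<noteq> 0 \<Longrightarrow> (\<integral>\<^sup>+x. ennreal (\<bar>c * (x - tb p b)\<bar> powr p) \<partial>measure_pmf (Xab (1 - b) b)) \<noteq> 0"
proof -
  let ?P = "measure_pmf (Xab (1 - b) b)" and ?t = "tb p b"
  have m: "(\<integral>y. c * (y - ?t) \<partial>?P) = - c * ?t"
    unfolding integral_Xab(1)[OF b] by (simp add: algebra_simps)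
  define F where "F = (1 - b) * \<bar>b - ?t\<bar> powr p + b * \<bar>1 - b + ?t\<bar> powr p"
  define G where "G = (1 - b) * b powr p + b * (1 - b) powr p"
  have GF: "G = R p b * F" unfolding G_def F_def by (rule two_point_moment_eq[OF p b])
  have Gpos: "G > 0" unfolding G_def using b by (intro add_pos_pos) auto
  have F0: "F \<ge> 0" unfolding F_def using b by (intro add_nonneg_nonneg mult_nonneg_nonneg) auto
  have Rpos: "R p b > 0" using R_pos[OF p] b by simp
  have E1: "(\<integral>\<^sup>+x. ennreal (\<bar>c * (x - ?t)\<bar> powr p) \<partial>?P) = ennreal (\<bar>c\<bar> powr p * F)"
  proof -
    have *: "\<bar>- (1 - b) - ?t\<bar> = \<bar>1 - b + ?t\<bar>" by arith
    show ?thesis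
      by (subst nn_integral_Xab_real[OF b powr_ge_zero])
        (simp only: abs_mult powr_mult abs_ge_zero * F_def distrib_left mult.left_commute)
  qed
  have E2: "(\<integral>\<^sup>+x. ennreal (\<bar>c * (x - ?t) - (\<integral>y. c * (y - ?t) \<partial>?P)\<bar> powr p) \<partial>?P) = ennreal (\<bar>c\<bar> powr p * G)"
  proof -
    have *: "c * (x - ?t) - - c * ?t = c * x" for x by (simp add: algebra_simps)
    have **: "\<bar>- (1 - b)\<bar> = 1 - b" "\<bar>b\<bar> = b" using b by auto
    show ?thesis
      unfolding m * by (subst nn_integral_Xab_real[OF b powr_ge_zero])
        (simp only: abs_mult powr_mult abs_ge_zero ** G_def distrib_left mult.left_commute)
  qed
  show "(\<integral>\<^sup>+x. ennreal (\<bar>c * (x - ?t) - (\<integral>y. c * (y - ?t) \<partial>?P)\<bar> powr p) \<partial>?P) =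
      ennreal (R p b) * (\<integral>\<^sup>+x. ennreal (\<bar>c * (x - ?t)\<bar> powr p) \<partial>?P)"
    unfolding E1 E2 GF using F0 Rpos by (simp add: mult.left_commute flip: ennreal_mult)
  show "(\<integral>\<^sup>+x. ennreal (\<bar>c * (x - ?t)\<bar> powr p) \<partial>?P) \<noteq> \<infinity>" unfolding E1 by simp
  have "F \<noteq> 0" using Gpos GF by auto
  then have "F > 0" using F0 by simp
  then show "c \<noteq> 0 \<Longrightarrow> (\<integral>\<^sup>+x. ennreal (\<bar>c * (x - ?t)\<bar> powr p) \<partial>?P) \<noteq> 0"
    unfolding E1 by (simp add: ennreal_eq_0_iff not_le)
qed

text \<open>\<open>Cp\<close> ranges over probability measures on the reals only. The extremal law
  is one of them and the upper bound holds over every type, so the restriction does not change the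
  constant.\<close>

lemma Cp_eq:
  assumes p: "p > 1"
  shows "Cp p = ennreal (R p (bmax p))"
proof (rule antisym)
  show "Cp p \<le> ennreal (R p (bmax p))"
    unfolding Cp_def by (rule Inf_lower) (simp add: recentering_inequality p)
  show "ennreal (R p (bmax p)) \<le> Cp p"
    unfolding Cp_def
  proof (rule Inf_greatest, drule CollectD)
    fix C :: ennreal
    let ?b = "bmax p"
    let ?P = "measure_pmf (Xab (1 - ?b) ?b)" and ?X = "\<lambda>x. 1 * (x - tb p ?b)"
    let ?E = "\<integral>\<^sup>+x. ennreal (\<bar>?X x\<bar> powr p) \<partial>?P"
    have b: "0 < ?b" "?b < 1" using bmax_bounds[OF p] by auto
    assume C: "\<forall>(M::real measure) X. prob_space M \<and> X \<in> borel_measurable M \<and> integrable M X \<longrightarrow>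
      (\<integral>\<^sup>+x. ennreal (\<bar>X x - (\<integral>y. X y \<partial>M)\<bar> powr p) \<partial>M) \<le> C * (\<integral>\<^sup>+x. ennreal (\<bar>X x\<bar> powr p) \<partial>M)"
    have "ennreal (R p ?b) * ?E \<le> C * ?E"
      unfolding Xab_moments(1)[OF p b, symmetric]
    proof (rule C[rule_format, of ?P ?X], intro conjI)
      show "integrable ?P ?X" by (rule integral_Xab(2)[OF b])
    qed (simp_all add: prob_space_measure_pmf)
    then have "?E * ennreal (R p ?b) \<le> ?E * C" by (simp only: mult.commute)
    moreover have "?E \<noteq> 0" "?E \<noteq> top" using Xab_moments(2,3)[OF p b, of 1] by simp_all
    ultimately show "ennreal (R p ?b) \<le> C"
      using ennreal_mult_le_mult_iff by blast
  qed
qed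

section \<open>The equality case\<close>

lemma distr_Xab_affine:
  assumes b: "0 < b" "b < 1" and A: "A \<in> sets borel"
  shows "emeasure (distr (measure_pmf (Xab (1 - b) b)) borel (\<lambda>x. c * (x - t))) A =
    indicator A (c * (b - t)) * ennreal (1 - b) + indicator A (c * (- (1 - b) - t)) * ennreal b"
proof -
  let ?P = "measure_pmf (Xab (1 - b) b)" and ?g = "\<lambda>x. c * (x - t)"
  have "emeasure (distr ?P borel ?g) A = emeasure ?P (?g -` A)"
    using A by (subst emeasure_distr) auto
  also have "\<dots> = (\<integral>\<^sup>+x. indicator A (?g x) \<partial>?P)"
    by (simp add: indicator_vimage flip: nn_integral_indicator)
  also have "\<dots> = indicator A (c * (b - t)) * ennreal (1 - b) + indicator A (c * (- (1 - b) - t)) * ennreal b"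
    by (rule nn_integral_Xab[OF b])
  finally show ?thesis .
qed

text \<open>On two distinct points the mean determines the probabilities: it gives (u - v)(P(X = u)
  - (1 - b)) = 0.\<close>

lemma distr_two_valued:
  fixes X :: "'a \<Rightarrow> real"
  assumes "prob_space M" and X[measurable]: "X \<in> borel_measurable M"
    and AE: "AE x in M. X x = u \<or> X x = v" and uv: "u \<noteq> v"
    and mean: "(\<integral>x. X x \<partial>M) = u * (1 - b) + v * b" and A: "A \<in> sets borel"
  shows "emeasure (distr M borel X) A = indicator A u * ennreal (1 - b) + indicator A v * ennreal b"
proof -
  interpret prob_space M by fact
  define U where "U = {x \<in> space M. X x = u}"
  define V where "V = {x \<in> space M. X x = v}"
  have UV[measurable]: "U \<in> events" "V \<in> events" by (simp_all add: U_def V_def)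
  have "AE x in M. X x = u * indicator U x + v * indicator V x"
    using AE AE_space by eventually_elim (use uv in \<open>auto simp: U_def V_def indicator_def\<close>)
  then have "(\<integral>x. X x \<partial>M) = (\<integral>x. u * indicator U x + v * indicator V x \<partial>M)"
    by (intro integral_cong_AE) auto
  also have "\<dots> = u * prob U + v * prob V"
    by (subst Bochner_Integration.integral_add)
      (auto intro!: integrable_real_indicator simp: less_top[symmetric])
  finally have m: "(\<integral>x. X x \<partial>M) = u * prob U + v * prob V" .
  have "AE x in M. x \<in> U \<union> V"
    using AE AE_space by eventually_elim (auto simp: U_def V_def)
  then have "prob (U \<union> V) = 1" by (subst prob_eq_1) auto
  moreover have "U \<inter> V = {}" using uv by (auto simp: U_def V_def)
  ultimately have s: "prob U + prob V = 1" by (simp add: finite_measure_Union)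
  have pV: "prob V = 1 - prob U" using s by simp
  have "u * prob U + v * (1 - prob U) = u * (1 - b) + v * b"
    using m mean unfolding pV by (rule trans[OF sym])
  then have "(u - v) * (prob U - (1 - b)) = 0" by algebra
  then have pU: "prob U = 1 - b" "prob V = b" using uv s by auto
  have "emeasure (distr M borel X) A = (\<integral>\<^sup>+x. indicator A (X x) \<partial>M)"
    using A by (subst nn_integral_indicator[symmetric], simp, subst nn_integral_distr) auto
  also have "\<dots> = (\<integral>\<^sup>+x. indicator A u * indicator U x + indicator A v * indicator V x \<partial>M)"
    using AE AE_space
    by (intro nn_integral_cong_AE, eventually_elim) (use uv in \<open>auto simp: U_def V_def indicator_def\<close>)
  also have "\<dots> = indicator A u * emeasure M U + indicator A v * emeasure M V"
    by (subst nn_integral_add) (auto simp: nn_integral_cmult)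
  finally show ?thesis by (simp add: emeasure_eq_measure pU)
qed

text \<open>For \<open>x < 1 < y\<close> in the contact set, \<open>b = (y - 1) / (y - x)\<close> maximizes \<^const>\<open>R\<close> and
  \<open>tb p b = -1 / (y - x) < 0\<close>. Since \<open>tb\<close> changes sign under \<open>b \<mapsto> 1 - b\<close>, this determines
  \<open>b\<close>, hence \<open>y - x\<close>, hence \<open>x\<close> and \<open>y\<close>.\<close>
lemma contact_pair_unique:
  fixes p r :: real
  assumes p: "p > 1" "p \<noteq> 2"
    and Z: "\<forall>x\<in>Z. \<bar>x - 1\<bar> powr p = R p (bp p) * \<bar>x\<bar> powr p - r * (x - 1)"
    and xy: "x \<in> Z" "x < 1" "y \<in> Z" "1 < y" "x' \<in> Z" "x' < 1" "y' \<in> Z" "1 < y'"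
  shows "x = x'" "y = y'" "(y - 1) / (y - x) = bp p \<or> (y - 1) / (y - x) = 1 - bp p"
    "tb p ((y - 1) / (y - x)) = - 1 / (y - x)"
proof -
  have pair: "((y - 1) / (y - x) = bp p \<or> (y - 1) / (y - x) = 1 - bp p) \<and> tb p ((y - 1) / (y - x)) = - 1 / (y - x)"
    if "x \<in> Z" "x < 1" "y \<in> Z" "1 < y" for x y
  proof -
    have K: "R p b \<le> R p (bp p)" if "0 < b" "b < 1" for b using R_le_bp[OF p, of b] that by simp
    \<comment> \<open>In this combination of the two contact equations the slope terms r(y - 1)(x -
      1) cancel.\<close>
    have "(y - 1) * \<bar>x - 1\<bar> powr p + (1 - x) * \<bar>y - 1\<bar> powr p =
      R p (bp p) * ((y - 1) * \<bar>x\<bar> powr p + (1 - x) * \<bar>y\<bar> powr p)"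
      unfolding Z[rule_format, OF that(1)] Z[rule_format, OF that(3)] by algebra
    from two_point_recentering(2)[OF p(1) K that(2,4) this]
    have "R p ((y - 1) / (y - x)) = R p (bp p)" "tb p ((y - 1) / (y - x)) = - 1 / (y - x)" by auto
    then show ?thesis using R_eq_bp_iff[OF p, of "(y - 1) / (y - x)"] that by auto
  qed
  have tneg: "tb p (bp p) = - tb p (1 - bp p)"
    using tb_symmetric[of "bp p" p] bp_pos[OF p] bp_less_half[OF p] by simp
  have same: "\<beta> = \<beta>'" if "\<beta> = bp p \<or> \<beta> = 1 - bp p" "\<beta>' = bp p \<or> \<beta>' = 1 - bp p" "tb p \<beta> < 0" "tb p \<beta>' < 0" for \<beta> \<beta>'
    using that tneg by (elim disjE) auto
  have uniq: "y - x = y' - x' \<and> y - 1 = y' - 1"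
    if "x \<in> Z" "x < 1" "y \<in> Z" "1 < y" "x' \<in> Z" "x' < 1" "y' \<in> Z" "1 < y'" for x y x' y'
  proof -
    have n: "- 1 / (y - x) < 0" "- 1 / (y' - x') < 0" using that by (simp_all add: divide_neg_pos)
    have b: "(y - 1) / (y - x) = (y' - 1) / (y' - x')"
      using pair[OF that(1-4)] pair[OF that(5-8)] n by (intro same) auto
    then have "- 1 / (y - x) = - 1 / (y' - x')" using pair[OF that(1-4)] pair[OF that(5-8)] by metis
    then have "y - x = y' - x'" by (simp add: field_simps)
    then show ?thesis using b that by simp
  qed
  show "x = x'" "y = y'" using uniq[OF xy] by auto
  show "(y - 1) / (y - x) = bp p \<or> (y - 1) / (y - x) = 1 - bp p"
    "tb p ((y - 1) / (y - x)) = - 1 / (y - x)" using pair[OF xy(1-4)] by auto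
qed

text \<open>Almost all values of X/m lie in the contact set \<open>Z\<close>. It has points on both
  sides of 1, so \<open>contact_pair_unique\<close> reduces it to one pair, and the mean fixes the
  law.\<close>

lemma recentering_equality_imp_distr:
  fixes X :: "'a \<Rightarrow> real"
  assumes M: "prob_space M" and X: "X \<in> borel_measurable M" "integrable M X" and p: "p > 1" "p \<noteq> 2"
    and fin: "(\<integral>\<^sup>+x. ennreal (\<bar>X x\<bar> powr p) \<partial>M) \<noteq> \<infinity>"
    and eq: "(\<integral>x. \<bar>X x - (\<integral>y. X y \<partial>M)\<bar> powr p \<partial>M) = R p (bp p) * (\<integral>x. \<bar>X x\<bar> powr p \<partial>M)"
  shows "\<exists>c. distr M borel X = distr (measure_pmf (Xab (1 - bp p) (bp p))) borel (\<lambda>x. c * (x - tb p (bp p)))"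
proof -
  interpret prob_space M by fact
  define m where "m = (\<integral>y. X y \<partial>M)"
  note [measurable] = X(1)
  let ?K = "R p (bp p)" and ?b = "bp p"
  have b: "0 < ?b" "?b < 1" using bp_pos[OF p] bp_less_half[OF p] by auto
  show ?thesis
  proof (cases "m = 0")
    \<comment> \<open>With mean zero equality reads E|X|^p = C_p E|X|^p. Since C_p > 1, X vanishes
      almost surely, which is the law with c = 0.\<close>
    case True
    then have "(\<integral>x. \<bar>X x\<bar> powr p \<partial>M) = 0" using eq R_bp_gt_1[OF p] by (simp add: m_def)
    then have "AE x in M. \<bar>X x\<bar> powr p = 0"
      using powr_moment_integrable(1)[OF M X(1) p(1) fin] integral_nonneg_eq_0_iff_AE[of M "\<lambda>x. \<bar>X x\<bar> powr p"] by simp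
    then have "AE x in M. X x = 0" by eventually_elim simp
    then have "distr M borel X = distr M borel (\<lambda>_. 0)" by (intro distr_cong_AE) auto
    also have "\<dots> = return borel 0" by (simp add: distr_const)
    also have "\<dots> = distr (measure_pmf (Xab (1 - ?b) ?b)) borel (\<lambda>x. 0 * (x - tb p ?b))"
      by (simp add: prob_space.distr_const[OF prob_space_measure_pmf])
    finally show ?thesis by blast
  next
    case False
    have K: "R p b \<le> ?K" if "0 < b" "b < 1" for b using R_le_bp[OF p, of b] that by simp
    obtain r where r: "\<And>x. \<bar>x - 1\<bar> powr p \<le> ?K * \<bar>x\<bar> powr p - r * (x - 1)"
      using ex_recentering_slope[OF p(1) K] by blast
    define Z where "Z = {x. \<bar>x - 1\<bar> powr p = ?K * \<bar>x\<bar> powr p - r * (x - 1)}"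
    have AEZ: "AE x in M. X x / m \<in> Z"
      using recentering_real(2)[OF M X p(1) fin r m_def False] eq by (simp add: m_def Z_def)
    \<comment> \<open>At 1 the pointwise inequality reads 0 <= C_p, which is strict.\<close>
    have Z1: "1 \<notin> Z" using R_bp_gt_1[OF p] by (simp add: Z_def)
    have mean1: "(\<integral>x. X x / m \<partial>M) = 1" using False by (simp add: m_def)
    have intm: "integrable M (\<lambda>x. X x / m)" using X by simp
    have ne: False if "AE x in M. X x / m = 1"
    proof -
      have "AE x in M. False" using that AEZ by eventually_elim (use Z1 in auto)
      then show False by simp
    qed
    \<comment> \<open>Otherwise X/m - 1 is nonnegative with mean zero, so X/m = 1 almost surely,
      against 1 \<notin> \<open>Z\<close>.\<close>
    have "\<exists>x0\<in>Z. x0 < 1"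
    proof (rule ccontr)
      assume "\<not> ?thesis"
      then have "0 \<le> x - 1" if "x \<in> Z" for x using that by force
      then have g: "AE x in M. 0 \<le> X x / m - 1" using AEZ by auto
      have "(\<integral>x. X x / m - 1 \<partial>M) = 0" using intm mean1 by (simp add: prob_space)
      then have "AE x in M. X x / m - 1 = 0"
        using integral_nonneg_eq_0_iff_AE[OF _ g] intm by simp
      then show False using ne by simp
    qed
    then obtain x0 where x0: "x0 \<in> Z" "x0 < 1" by blast
    have "\<exists>y0\<in>Z. 1 < y0"
    proof (rule ccontr)
      assume "\<not> ?thesis"
      then have "0 \<le> 1 - x" if "x \<in> Z" for x using that by force
      then have g: "AE x in M. 0 \<le> 1 - X x / m" using AEZ by auto
      have "(\<integral>x. 1 - X x / m \<partial>M) = 0" using intm mean1 by (simp add: prob_space)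
      then have "AE x in M. 1 - X x / m = 0"
        using integral_nonneg_eq_0_iff_AE[OF _ g] intm by simp
      then show False using ne by simp
    qed
    then obtain y0 where y0: "y0 \<in> Z" "1 < y0" by blast
    have ZD: "\<forall>x\<in>Z. \<bar>x - 1\<bar> powr p = ?K * \<bar>x\<bar> powr p - r * (x - 1)"
      by (simp add: Z_def)
    note uniq = contact_pair_unique[OF p ZD x0 y0]
    have AE2: "AE x in M. X x = m * y0 \<or> X x = m * x0"
      using AEZ
    proof eventually_elim
      case (elim x)
      have "X x / m = x0 \<or> X x / m = y0"
      proof (cases "X x / m < 1")
        case True
        then show ?thesis using uniq(1)[OF elim True y0] by simp
      next
        case False
        moreover have "X x / m \<noteq> 1" using elim Z1 by metis
        ultimately have "X x / m > 1" by linarith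
        then show ?thesis using uniq(2)[OF x0 elim] by simp
      qed
      then show ?case using False by (auto simp: field_simps)
    qed
    define l where "l = y0 - x0"
    define \<beta> where "\<beta> = (y0 - 1) / l"
    have l: "l > 0" using x0 y0 by (simp add: l_def)
    have \<beta>: "\<beta> = ?b \<or> \<beta> = 1 - ?b" and t: "tb p \<beta> = - 1 / l"
      using uniq(3,4)[OF x0 y0] by (simp_all add: \<beta>_def l_def)
    have "l * \<beta> = y0 - 1" "l * tb p \<beta> = - 1" using l t by (simp_all add: \<beta>_def)
    then have y0': "y0 = l * (\<beta> - tb p \<beta>)" and x0': "x0 = l * (- (1 - \<beta>) - tb p \<beta>)"
      by (simp_all add: algebra_simps) (simp add: l_def)
    have "y0 * (1 - \<beta>) + x0 * \<beta> = y0 - l * \<beta>" by (simp add: l_def algebra_simps)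
    then have "y0 * (1 - \<beta>) + x0 * \<beta> = 1" using \<open>l * \<beta> = y0 - 1\<close> by simp
    then have "m * (y0 * (1 - \<beta>) + x0 * \<beta>) = m" by simp
    then have mean: "(\<integral>x. X x \<partial>M) = m * y0 * (1 - \<beta>) + m * x0 * \<beta>"
      unfolding m_def[symmetric] by (simp only: distrib_left mult.assoc)
    have neq: "m * y0 \<noteq> m * x0" using False x0 y0 by simp
    from \<beta> show ?thesis
    proof
      assume "\<beta> = ?b"
      show ?thesis
      proof (intro exI measure_eqI)
        fix A assume "A \<in> sets (distr M borel X)"
        then have A: "A \<in> sets borel" by simp
        have "emeasure (distr M borel X) A = indicator A (m * y0) * ennreal (1 - \<beta>) + indicator A (m * x0) * ennreal \<beta>"
          by (rule distr_two_valued[OF M X(1) AE2 neq mean A])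
        then show "emeasure (distr M borel X) A =
            emeasure (distr (measure_pmf (Xab (1 - ?b) ?b)) borel (\<lambda>x. (m * l) * (x - tb p ?b))) A"
          unfolding distr_Xab_affine[OF b A] by (simp add: y0' x0' \<open>\<beta> = ?b\<close> mult.assoc)
      qed simp
    next
      \<comment> \<open>The mirror case: X_{b,1-b} has the law of -X_{1-b,b} and \<open>tb\<close>
        changes sign, so the factor c becomes -ml.\<close>
      assume "\<beta> = 1 - ?b"
      then have tb': "tb p \<beta> = - tb p ?b" using tb_symmetric[OF b] by simp
      show ?thesis
      proof (intro exI measure_eqI)
        fix A assume "A \<in> sets (distr M borel X)"
        then have A: "A \<in> sets borel" by simp
        have "emeasure (distr M borel X) A = indicator A (m * y0) * ennreal (1 - \<beta>) + indicator A (m * x0) * ennreal \<beta>"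
          by (rule distr_two_valued[OF M X(1) AE2 neq mean A])
        moreover have "m * y0 = - (m * l) * (- (1 - ?b) - tb p ?b)" "m * x0 = - (m * l) * (?b - tb p ?b)"
          unfolding y0' x0' tb' unfolding \<open>\<beta> = 1 - ?b\<close> by (simp_all add: algebra_simps)
        ultimately show "emeasure (distr M borel X) A =
            emeasure (distr (measure_pmf (Xab (1 - ?b) ?b)) borel (\<lambda>x. - (m * l) * (x - tb p ?b))) A"
          unfolding distr_Xab_affine[OF b A] by (simp add: \<open>\<beta> = 1 - ?b\<close> add.commute)
      qed simp
    qed
  qed
qed


lemma recentering_equality_iff:
  fixes X :: "'a \<Rightarrow> real"
  assumes M: "prob_space M" and X: "X \<in> borel_measurable M" "integrable M X" and p: "p > 1" "p \<noteq> 2"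
  shows "(\<integral>\<^sup>+x. ennreal (\<bar>X x - (\<integral>y. X y \<partial>M)\<bar> powr p) \<partial>M)
        = ennreal (R p (bp p)) * (\<integral>\<^sup>+x. ennreal (\<bar>X x\<bar> powr p) \<partial>M) \<longleftrightarrow>
      (\<integral>\<^sup>+x. ennreal (\<bar>X x\<bar> powr p) \<partial>M) = \<infinity> \<or>
      (\<exists>c. distr M borel X = distr (measure_pmf (Xab (1 - bp p) (bp p))) borel (\<lambda>x. c * (x - tb p (bp p))))"
    (is "?L = ennreal ?K * ?E \<longleftrightarrow> _ \<or> ?D")
proof -
  interpret prob_space M by fact
  note [measurable] = X(1)
  have b: "0 < bp p" "bp p < 1" using bp_pos[OF p] bp_less_half[OF p] by auto
  have K: "?K > 1" by (rule R_bp_gt_1[OF p])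
  have inf: "?L = ennreal ?K * ?E" if "?E = \<infinity>"
  proof -
    have "?L = \<infinity>"
    proof (rule ccontr)
      define m where "m = (\<integral>y. X y \<partial>M)"
      assume "?L \<noteq> \<infinity>"
      then have "(\<integral>\<^sup>+x. ennreal (\<bar>(X x - m)\<bar> powr p) \<partial>M) \<noteq> \<infinity>" by (simp add: m_def)
      \<comment> \<open>Adding the mean back to X - m keeps the moment finite, so an infinite moment
        of X forces an infinite centered one.\<close>
      from powr_moment_integrable(2)[OF M _ p(1) this, of "- m"]
      have "integrable M (\<lambda>x. \<bar>X x\<bar> powr p)" by simp
      then have "?E = ennreal (\<integral>x. \<bar>X x\<bar> powr p \<partial>M)" by (intro nn_integral_eq_integral) auto
      then show False using that by simp
    qed
    then show ?thesis using that K by (simp add: ennreal_mult_top)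
  qed
  have imp: ?D if "?L = ennreal ?K * ?E" "?E \<noteq> \<infinity>"
  proof (rule recentering_equality_imp_distr[OF M X p that(2)])
    have "(\<integral>x. \<bar>X x\<bar> powr p \<partial>M) \<ge> 0" "(\<integral>x. \<bar>X x - (\<integral>y. X y \<partial>M)\<bar> powr p \<partial>M) \<ge> 0"
      by (intro Bochner_Integration.integral_nonneg, simp)+
    then show "(\<integral>x. \<bar>X x - (\<integral>y. X y \<partial>M)\<bar> powr p \<partial>M) = ?K * (\<integral>x. \<bar>X x\<bar> powr p \<partial>M)"
      using that(1) K unfolding nn_integral_eq_moment[OF M X(1) p(1) that(2)]
      by (simp flip: ennreal_mult)
  qed
  have conv: "?L = ennreal ?K * ?E" if D: ?D
  proof -
    let ?P = "measure_pmf (Xab (1 - bp p) (bp p))"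
    obtain c where c: "distr M borel X = distr ?P borel (\<lambda>x. c * (x - tb p (bp p)))" using D by blast
    let ?g = "\<lambda>x. c * (x - tb p (bp p))"
    have nn: "(\<integral>\<^sup>+x. f (X x) \<partial>M) = (\<integral>\<^sup>+x. f (?g x) \<partial>?P)" if [measurable]: "f \<in> borel_measurable borel" for f
    proof -
      have "(\<integral>\<^sup>+x. f (X x) \<partial>M) = (\<integral>\<^sup>+x. f x \<partial>distr M borel X)" by (subst nn_integral_distr) auto
      also have "\<dots> = (\<integral>\<^sup>+x. f (?g x) \<partial>?P)" unfolding c by (subst nn_integral_distr) auto
      finally show ?thesis .
    qed
    have "(\<integral>x. X x \<partial>M) = (\<integral>x. x \<partial>distr M borel X)" by (subst integral_distr) auto
    also have "\<dots> = (\<integral>x. ?g x \<partial>?P)" unfolding c by (subst integral_distr) auto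
    finally have m: "(\<integral>x. X x \<partial>M) = (\<integral>x. ?g x \<partial>?P)" .
    have 1: "?L = (\<integral>\<^sup>+x. ennreal (\<bar>?g x - (\<integral>y. ?g y \<partial>?P)\<bar> powr p) \<partial>?P)"
      unfolding m by (rule nn) simp
    have 2: "?E = (\<integral>\<^sup>+x. ennreal (\<bar>?g x\<bar> powr p) \<partial>?P)"
      by (rule nn) simp
    show ?thesis unfolding 1 2 by (rule Xab_moments(1)[OF p(1) b])
  qed
  show ?thesis using inf imp conv by blast
qed

text \<open>At p = 2 \<open>R\<close> is constant and singles out no pair of points. The identity
  E(X - m)^2 = EX^2 - m^2 decides equality directly.\<close>

lemma recentering_equality_iff_2:
  fixes X :: "'a \<Rightarrow> real"
  assumes M: "prob_space M" and X: "X \<in> borel_measurable M" "integrable M X"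
  shows "(\<integral>\<^sup>+x. ennreal (\<bar>X x - (\<integral>y. X y \<partial>M)\<bar> powr 2) \<partial>M) = (\<integral>\<^sup>+x. ennreal (\<bar>X x\<bar> powr 2) \<partial>M) \<longleftrightarrow>
      (\<integral>\<^sup>+x. ennreal (\<bar>X x\<bar> powr 2) \<partial>M) = \<infinity> \<or>
      ((\<integral>\<^sup>+x. ennreal ((X x)\<^sup>2) \<partial>M) < \<infinity> \<and> (\<integral>y. X y \<partial>M) = 0)"
    (is "?L = ?E \<longleftrightarrow> _")
proof -
  interpret prob_space M by fact
  note [measurable] = X(1)
  define m where "m = (\<integral>y. X y \<partial>M)"
  have sq: "\<bar>x\<bar> powr 2 = x\<^sup>2" for x :: real by (cases "x = 0") (simp_all add: powr_numeral)
  show ?thesis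
  proof (cases "?E = \<infinity>")
    case True
    have "?L = \<infinity>"
    proof (rule ccontr)
      assume "?L \<noteq> \<infinity>"
      then have "(\<integral>\<^sup>+x. ennreal (\<bar>(X x - m)\<bar> powr 2) \<partial>M) \<noteq> \<infinity>" by (simp add: m_def)
      from powr_moment_integrable(2)[OF M _ _ this, of "- m"]
      have "integrable M (\<lambda>x. \<bar>X x\<bar> powr 2)" by simp
      then have "?E = ennreal (\<integral>x. \<bar>X x\<bar> powr 2 \<partial>M)" by (intro nn_integral_eq_integral) auto
      then show False using True by simp
    qed
    then show ?thesis using True by simp
  next
    case False
    note I = powr_moment_integrable(1)[OF M X(1) _ False, unfolded sq]
    have "(\<integral>x. (X x - m)\<^sup>2 \<partial>M) = (\<integral>x. (X x)\<^sup>2 - 2 * m * X x + m\<^sup>2 \<partial>M)"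
      by (simp add: power2_diff algebra_simps)
    also have "\<dots> = (\<integral>x. (X x)\<^sup>2 \<partial>M) - m\<^sup>2"
      using I X by (simp add: prob_space m_def power2_eq_square)
    finally have v: "(\<integral>x. (X x - m)\<^sup>2 \<partial>M) = (\<integral>x. (X x)\<^sup>2 \<partial>M) - m\<^sup>2" .
    have nn: "(\<integral>x. (X x)\<^sup>2 \<partial>M) \<ge> 0" "(\<integral>x. (X x - m)\<^sup>2 \<partial>M) \<ge> 0"
      by (intro Bochner_Integration.integral_nonneg, simp)+
    have "?L = ennreal (\<integral>x. (X x - m)\<^sup>2 \<partial>M)" "?E = ennreal (\<integral>x. (X x)\<^sup>2 \<partial>M)"
      using nn_integral_eq_moment[OF M X(1) _ False] by (simp_all add: sq m_def)
    then have "?L = ?E \<longleftrightarrow> m = 0" using nn v by simp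
    then show ?thesis using False by (simp add: sq m_def less_top[symmetric])
  qed
qed

section \<open>Duality, log-convexity and asymptotics\<close>

lemma Cr_eq: "p > 1 \<Longrightarrow> Cr p = R p (bmax p)"
  using R_bmax_ge_1[of p] by (simp add: Cr_def Cp_eq)

lemma R_le_Cr: "p > 1 \<Longrightarrow> 0 \<le> b \<Longrightarrow> b \<le> 1 \<Longrightarrow> R p b \<le> Cr p"
  by (simp add: Cr_eq R_le_bmax)

lemma Cr_2: "Cr 2 = 1"
  by (simp add: Cr_eq bmax_def R_2)

lemma Cr_ge_1: "p > 1 \<Longrightarrow> Cr p \<ge> 1"
  by (simp add: Cr_eq R_bmax_ge_1)

lemma Cr_gt_1: "p > 1 \<Longrightarrow> p \<noteq> 2 \<Longrightarrow> Cr p > 1"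
  using R_bp_gt_1 by (simp add: Cr_eq bmax_def)

lemma Cr_conjugate:
  assumes "p > 1" "q > 1" "(p - 1) * (q - 1) = 1"
  shows "Cr q = Cr p powr (1 / (p - 1))"
proof (cases "p = 2")
  case True
  then have "q = 2" using assms by simp
  then show ?thesis using True by (simp add: Cr_2)
next
  case False
  then have "q \<noteq> 2" using assms by auto
  then show ?thesis
    using False assms bp_conjugate[OF assms False] R_conjugate[OF assms, of "bp p"]
      bp_pos[OF assms(1) False] bp_less_half[OF assms(1) False]
    by (simp add: Cr_eq bmax_def)
qed

lemma ln_two_point_mean_gt:
  fixes w P Q :: real
  assumes "0 < w" "w < 1" "P > 0" "Q > 0" "P \<noteq> Q"
  shows "ln (w * P + (1 - w) * Q) > w * ln P + (1 - w) * ln Q"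
proof -
  define T where "T = w * P + (1 - w) * Q"
  have T: "T > 0" using assms by (simp add: T_def add_pos_pos)
  have "P \<noteq> T"
  proof
    assume "P = T"
    then have "(1 - w) * (P - Q) = 0" by (simp add: T_def algebra_simps)
    then show False using assms by simp
  qed
  then have "ln (P / T) < P / T - 1"
    using ln_le_minus_one[of "P / T"] ln_eq_minus_one[of "P / T"] T assms by fastforce
  then have 1: "w * (ln P - ln T) < w * (P / T - 1)" using assms T by (simp add: ln_div)
  have "ln (Q / T) \<le> Q / T - 1" using T assms by (intro ln_le_minus_one) auto
  then have 2: "(1 - w) * (ln Q - ln T) \<le> (1 - w) * (Q / T - 1)"
    using assms T by (intro mult_left_mono) (auto simp: ln_div)
  have "w * (P / T - 1) + (1 - w) * (Q / T - 1) = (w * P + (1 - w) * Q) / T - 1"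
    by (simp add: algebra_simps add_divide_distrib diff_divide_distrib)
  also have "\<dots> = 0" using T by (simp flip: T_def)
  finally show ?thesis unfolding T_def[symmetric] using 1 2 by (simp add: algebra_simps)
qed

text \<open>Convexity of a log-sum-exp: d is the mean of ln b and ln(1 - b) under the weights tilted
  by z. The two logarithms differ because b < 1/2, and this makes the inequality strict.\<close>

lemma ln_powr_sum_tangent:
  fixes b z :: real
  assumes "0 < b" "b < 1/2"
  obtains d where "\<And>x. x \<noteq> z \<Longrightarrow>
    ln (b powr x + (1 - b) powr x) > ln (b powr z + (1 - b) powr z) + d * (x - z)"
proof -
  define A where "A = b powr z + (1 - b) powr z"
  define w where "w = b powr z / A"
  define d where "d = w * ln b + (1 - w) * ln (1 - b)"
  have A: "A > 0" using assms by (simp add: A_def powr_sum_pos)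
  have w: "1 - w = (1 - b) powr z / A" using A by (simp add: w_def field_simps) (simp add: A_def)
  have "0 < w" "0 < 1 - w" unfolding w using A assms by (simp_all add: w_def)
  then have w01: "0 < w" "w < 1" by auto
  have "ln (b powr x + (1 - b) powr x) > ln A + d * (x - z)" if "x \<noteq> z" for x
  proof -
    have "ln b < ln (1 - b)" using assms by simp
    then have "(x - z) * ln b \<noteq> (x - z) * ln (1 - b)" using that by simp
    then have ne: "b powr (x - z) \<noteq> (1 - b) powr (x - z)" using assms by (simp add: powr_def)
    have "A * (w * b powr (x - z) + (1 - w) * (1 - b) powr (x - z)) = b powr x + (1 - b) powr x"
    proof -
      have "A * w = b powr z" "A * (1 - w) = (1 - b) powr z" unfolding w using A by (simp_all add: w_def)
      moreover have "A * (w * P + (1 - w) * Q) = A * w * P + A * (1 - w) * Q" for P Q by algebra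
      ultimately show ?thesis using assms by (simp flip: powr_add)
    qed
    moreover have "w * b powr (x - z) + (1 - w) * (1 - b) powr (x - z) > 0"
      using w01 assms by (intro add_pos_pos mult_pos_pos) auto
    ultimately have 1: "ln (b powr x + (1 - b) powr x) = ln A + ln (w * b powr (x - z) + (1 - w) * (1 - b) powr (x - z))"
      using A by (metis ln_mult_pos)
    have 2: "ln (w * b powr (x - z) + (1 - w) * (1 - b) powr (x - z)) > w * ln (b powr (x - z)) + (1 - w) * ln ((1 - b) powr (x - z))"
      using assms w01 ne by (intro ln_two_point_mean_gt) auto
    have "w * ln (b powr (x - z)) + (1 - w) * ln ((1 - b) powr (x - z)) = d * (x - z)"
      using assms by (simp add: ln_powr d_def algebra_simps)
    then show ?thesis using 1 2 by simp
  qed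
  then show ?thesis using that unfolding A_def by blast
qed

lemma ln_R:
  assumes "p > 1" "0 < b" "b < 1"
  shows "ln (R p b) = ln (b powr (p - 1) + (1 - b) powr (p - 1))
    + (p - 1) * ln (b powr (1 / (p - 1)) + (1 - b) powr (1 / (p - 1)))"
proof -
  let ?g = "b powr (1 / (p - 1)) + (1 - b) powr (1 / (p - 1))"
  have pos: "b powr x + (1 - b) powr x > 0" for x using assms by (intro powr_sum_pos) auto
  have "?g powr (p - 1) > 0" using pos[of "1 / (p - 1)"] by simp
  then show ?thesis unfolding R_def by (simp only: ln_mult_pos[OF pos] ln_powr)
qed

text \<open>With \<open>\<psi> x = ln (b\<^sup>x + (1 - b)\<^sup>x)\<close>, \<open>ln R\<close> is \<open>\<psi> s + s \<psi> (1 / s)\<close> at \<open>s = p - 1\<close>; the second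
  term is the perspective of the convex function \<open>\<psi>\<close>.\<close>
lemma ln_R_tangent:
  assumes z: "z > 1" and b: "0 < b" "b < 1/2"
  obtains k where "\<And>x. x > 1 \<Longrightarrow> x \<noteq> z \<Longrightarrow> ln (R x b) > ln (R z b) + k * (x - z)"
proof -
  define \<psi> where "\<psi> = (\<lambda>x. ln (b powr x + (1 - b) powr x))"
  obtain d1 where d1: "\<And>x. x \<noteq> z - 1 \<Longrightarrow> \<psi> x > \<psi> (z - 1) + d1 * (x - (z - 1))"
    using ln_powr_sum_tangent[OF b, of "z - 1"] unfolding \<psi>_def by metis
  obtain d2 where d2: "\<And>x. x \<noteq> 1 / (z - 1) \<Longrightarrow> \<psi> x > \<psi> (1 / (z - 1)) + d2 * (x - 1 / (z - 1))"
    using ln_powr_sum_tangent[OF b, of "1 / (z - 1)"] unfolding \<psi>_def by metis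
  \<comment> \<open>The derivative in s of \<psi>(s) + s \<psi>(1/s), with d1 and d2 as the slopes
    of \<psi> at s and 1/s.\<close>
  define k where "k = d1 + \<psi> (1 / (z - 1)) - d2 / (z - 1)"
  have "ln (R x b) > ln (R z b) + k * (x - z)" if x: "x > 1" "x \<noteq> z" for x
  proof -
    have 1: "\<psi> (x - 1) > \<psi> (z - 1) + d1 * (x - z)" using d1[of "x - 1"] x by simp
    have "\<psi> (1 / (x - 1)) > \<psi> (1 / (z - 1)) + d2 * (1 / (x - 1) - 1 / (z - 1))"
      using x z by (intro d2) (auto simp: field_simps)
    then have "(x - 1) * \<psi> (1 / (x - 1)) > (x - 1) * (\<psi> (1 / (z - 1)) + d2 * (1 / (x - 1) - 1 / (z - 1)))"
      using x by simp
    also have "(x - 1) * (\<psi> (1 / (z - 1)) + d2 * (1 / (x - 1) - 1 / (z - 1))) =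
        (z - 1) * \<psi> (1 / (z - 1)) + (\<psi> (1 / (z - 1)) - d2 / (z - 1)) * (x - z)"
    proof -
      have "X * (P + D * (1 / X - 1 / Z)) = Z * P + (P - D / Z) * (X - Z)" if "X \<noteq> 0" "Z \<noteq> 0" for X Z P D :: real
        using that by (simp add: field_simps)
      from this[of "x - 1" "z - 1"] show ?thesis using x z by simp
    qed
    finally show ?thesis using 1 b x z
      by (simp add: ln_R k_def \<psi>_def algebra_simps)
  qed
  then show ?thesis by (rule that)
qed

text \<open>Freeze b at the maximizer for z. Then \<open>R x b\<close> lies below
  \<open>Cr x\<close> and meets it at x = z, so its supporting line passes to ln C.\<close>

lemma ln_Cr_tangent:
  assumes z: "z > 1"
  obtains k where "\<And>x. x > 1 \<Longrightarrow> x \<noteq> z \<Longrightarrow> ln (Cr x) > ln (Cr z) + k * (x - z)"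
proof -
  have b: "0 < bmax z" "bmax z < 1/2" using bmax_bounds[OF z] by auto
  obtain k where k: "\<And>x. x > 1 \<Longrightarrow> x \<noteq> z \<Longrightarrow> ln (R x (bmax z)) > ln (R z (bmax z)) + k * (x - z)"
    using ln_R_tangent[OF z b] by blast
  have "ln (Cr x) > ln (Cr z) + k * (x - z)" if x: "x > 1" "x \<noteq> z" for x
  proof -
    have "ln (R x (bmax z)) \<le> ln (Cr x)"
      using R_le_Cr[OF x(1), of "bmax z"] R_pos[OF x(1), of "bmax z"] b by simp
    then show ?thesis using k[OF x] Cr_eq[OF z] by simp
  qed
  then show ?thesis by (rule that)
qed

lemma ln_Cr_strictly_convex: "strictly_convex_on {1<..} (\<lambda>p. ln (Cr p))"
  unfolding strictly_convex_on_def
proof (intro ballI allI impI)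
  fix x y u :: real
  assume xy: "x \<in> {1<..}" "y \<in> {1<..}" and u: "x \<noteq> y \<and> 0 < u \<and> u < 1"
  define z where "z = u * x + (1 - u) * y"
  have zx: "x - z = (1 - u) * (x - y)" and zy: "y - z = u * (y - x)" by (simp_all add: z_def algebra_simps)
  have "u * 1 + (1 - u) * 1 < z" unfolding z_def using xy u by (intro add_strict_mono mult_strict_left_mono) auto
  then have z: "z > 1" by simp
  have ne: "x \<noteq> z" "y \<noteq> z" using zx zy u by auto
  obtain k where k: "\<And>x. x > 1 \<Longrightarrow> x \<noteq> z \<Longrightarrow> ln (Cr x) > ln (Cr z) + k * (x - z)"
    using ln_Cr_tangent[OF z] by blast
  have "u * ln (Cr x) > u * (ln (Cr z) + k * (x - z))" using k[of x] ne xy u by simp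
  moreover have "(1 - u) * ln (Cr y) > (1 - u) * (ln (Cr z) + k * (y - z))" using k[of y] ne xy u by simp
  moreover have "u * (ln (Cr z) + k * (x - z)) + (1 - u) * (ln (Cr z) + k * (y - z)) = ln (Cr z)"
    unfolding zx zy by (simp add: algebra_simps)
  ultimately show "ln (Cr (u * x + (1 - u) * y)) < u * ln (Cr x) + (1 - u) * ln (Cr y)"
    unfolding z_def[symmetric] by linarith
qed

lemma continuous_on_Cr: "continuous_on {1<..} Cr"
proof -
  have "convex_on {1<..} (\<lambda>p. ln (Cr p))"
  proof (rule convex_onI)
    fix t x y :: real
    assume t: "0 < t" "t < 1" and xy: "x \<in> {1<..}" "y \<in> {1<..}"
    show "ln (Cr ((1 - t) *\<^sub>R x + t *\<^sub>R y)) \<le> (1 - t) * ln (Cr x) + t * ln (Cr y)"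
    proof (cases "x = y")
      case True
      then show ?thesis by (simp flip: scaleR_left_distrib distrib_right)
    next
      case False
      then show ?thesis
        using ln_Cr_strictly_convex[unfolded strictly_convex_on_def, rule_format, OF xy, of "1 - t"] t
        by simp
    qed
  qed simp
  then have "continuous_on {1<..} (\<lambda>p. ln (Cr p))"
    by (intro convex_on_continuous) auto
  then have "continuous_on {1<..} (\<lambda>p. exp (ln (Cr p)))" by (intro continuous_on_exp)
  then show ?thesis
    by (rule continuous_on_eq) (use Cr_ge_1 in \<open>force simp: less_le_trans[OF zero_less_one]\<close>)
qed

text \<open>ln C vanishes at 2 and is positive at y < 2, so a supporting line at y has negative
  slope; evaluating it at x < y gives the claim.\<close>

lemma Cr_strict_antimono:
  assumes "1 < x" "x < y" "y \<le> 2"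
  shows "Cr y < Cr x"
proof (cases "y = 2")
  case True
  then show ?thesis using Cr_gt_1[of x] assms by (simp add: Cr_2)
next
  case False
  have y: "y > 1" using assms by simp
  obtain k where k: "\<And>x. x > 1 \<Longrightarrow> x \<noteq> y \<Longrightarrow> ln (Cr x) > ln (Cr y) + k * (x - y)"
    using ln_Cr_tangent[OF y] by blast
  have "ln (Cr y) > 0" using Cr_gt_1[OF y False] by simp
  then have "k * (2 - y) < 0" using k[of 2] False by (simp add: Cr_2)
  then have "k < 0" using assms False by (simp add: mult_less_0_iff)
  then have "k * (x - y) > 0" using assms by (simp add: mult_neg_neg)
  then have "ln (Cr y) < ln (Cr x)" using k[of x] assms by simp
  then show ?thesis using Cr_ge_1[of x] Cr_ge_1[of y] assms by simp
qed

lemma Cr_strict_mono: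
  assumes "2 \<le> x" "x < y"
  shows "Cr x < Cr y"
proof (cases "x = 2")
  case True
  then show ?thesis using Cr_gt_1[of y] assms by (simp add: Cr_2)
next
  case False
  have x: "x > 1" using assms by simp
  obtain k where k: "\<And>y. y > 1 \<Longrightarrow> y \<noteq> x \<Longrightarrow> ln (Cr y) > ln (Cr x) + k * (y - x)"
    using ln_Cr_tangent[OF x] by blast
  have "ln (Cr x) > 0" using Cr_gt_1[OF x False] by simp
  then have "k * (2 - x) < 0" using k[of 2] False by (simp add: Cr_2)
  then have "k > 0" using assms False by (simp add: mult_less_0_iff)
  then have "k * (y - x) > 0" using assms by simp
  then have "ln (Cr x) < ln (Cr y)" using k[of y] assms by simp
  then show ?thesis using Cr_ge_1[of x] Cr_ge_1[of y] assms by simp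
qed

section \<open>Growth of C_p as p tends to infinity, and the limit at 1\<close>

lemma cosh_le_exp_half_square:
  fixes h :: real
  shows "cosh h \<le> exp (h\<^sup>2 / 2)"
proof -
  have sc: "sinh x \<le> x * cosh x" if "x \<ge> 0" for x :: real
  proof -
    have "0 * cosh 0 - sinh 0 \<le> x * cosh x - sinh (x::real)"
    proof (rule DERIV_nonneg_imp_nondecreasing[OF that])
      fix y :: real assume "0 \<le> y"
      then show "\<exists>D. ((\<lambda>x. x * cosh x - sinh x) has_real_derivative D) (at y) \<and> D \<ge> 0"
        by (intro exI[of _ "y * sinh y"]) (auto intro!: derivative_eq_intros)
    qed
    then show ?thesis by simp
  qed
  have "cosh x \<le> exp (x\<^sup>2 / 2)" if "x \<ge> 0" for x :: real
  proof -
    have "0\<^sup>2 / 2 - ln (cosh (0::real)) \<le> x\<^sup>2 / 2 - ln (cosh x)"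
    proof (rule DERIV_nonneg_imp_nondecreasing[OF that])
      fix y :: real assume y: "0 \<le> y"
      have "((\<lambda>x. x\<^sup>2 / 2 - ln (cosh x)) has_real_derivative (y - sinh y / cosh y)) (at y)"
        by (auto intro!: derivative_eq_intros simp: cosh_real_pos)
      \<comment> \<open>The derivative of ln cosh is tanh, which stays below the identity on the
        nonnegative axis.\<close>
      moreover have "y - sinh y / cosh y \<ge> 0"
        using sc[OF y] by (simp add: divide_le_eq cosh_real_pos mult.commute)
      ultimately show "\<exists>D. ((\<lambda>x. x\<^sup>2 / 2 - ln (cosh x)) has_real_derivative D) (at y) \<and> D \<ge> 0" by blast
    qed
    then have "ln (cosh x) \<le> x\<^sup>2 / 2" by simp
    then have "exp (ln (cosh x)) \<le> exp (x\<^sup>2 / 2)" by (simp only: exp_le_cancel_iff)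
    moreover have "exp (ln (cosh x)) = cosh x" by (simp add: cosh_real_pos)
    ultimately show ?thesis by simp
  qed
  from this[of "\<bar>h\<bar>"] show ?thesis by simp
qed

text \<open>The left side is exactly 2^s sqrt(ad) cosh(h)^s with h = (ln d - ln a)/(2s). Bounding
  cosh h by exp(h^2/2) leaves an error that is harmless as long as ln(d/a)^2 is small against
  s.\<close>

lemma powr_sum_le_geometric_mean:
  fixes a d s :: real
  assumes "a > 0" "d > 0" "s > 0"
  shows "(a powr (1 / s) + d powr (1 / s)) powr s \<le> 2 powr s * sqrt (a * d) * exp ((ln d - ln a)\<^sup>2 / (8 * s))"
proof -
  define h where "h = (ln d - ln a) / (2 * s)"
  define m where "m = (ln d + ln a) / (2 * s)"
  have ad: "ln a / s = m - h" "ln d / s = m + h" using assms by (simp_all add: h_def m_def field_simps)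
  have "a powr (1 / s) + d powr (1 / s) = exp (m - h) + exp (m + h)"
    using assms by (simp add: powr_def ad)
  also have "\<dots> = 2 * exp m * cosh h"
    by (simp add: cosh_field_def exp_add exp_diff exp_minus field_simps)
  also have "\<dots> \<le> 2 * exp m * exp (h\<^sup>2 / 2)"
    by (intro mult_left_mono cosh_le_exp_half_square) auto
  finally have "(a powr (1 / s) + d powr (1 / s)) powr s \<le> (2 * exp m * exp (h\<^sup>2 / 2)) powr s"
    using assms by (intro powr_mono2) (auto intro: add_nonneg_nonneg)
  also have "\<dots> = 2 powr s * exp (s * m) * exp (s * (h\<^sup>2 / 2))"
    by (simp add: powr_mult exp_powr_real mult.commute)
  also have "exp (s * m) = sqrt (a * d)"
  proof -
    have "s * m = ln (sqrt (a * d))" using assms by (simp add: m_def ln_sqrt ln_mult_pos)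
    then show ?thesis using assms by simp
  qed
  also have "s * (h\<^sup>2 / 2) = (ln d - ln a)\<^sup>2 / (8 * s)"
    using assms by (simp add: h_def power2_eq_square field_simps)
  finally show ?thesis .
qed

text \<open>For b >= 1/s^2 one has |ln((1 - b)/b)| <= 2 ln s, so the error factor \<open>E\<close>
  tends to 1, and the main term is 2^s (1 - b)^s sqrt(b(1 - b)). Smaller b contribute only the order
  2^s/s, below the main order 2^s/sqrt s.\<close>

lemma R_upper_bound:
  fixes p s b :: real
  assumes s: "s = p - 1" "s \<ge> 6" and b: "0 < b" "b < 1/2"
  shows "R p b \<le> 2 powr s * (1 / sqrt (2 * exp 1 * s) + 2 powr (- s)) * exp ((ln s)\<^sup>2 / (2 * s))"
proof -
  define E where "E = exp ((ln s)\<^sup>2 / (2 * s))"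
  define g where "g = (b powr (1 / s) + (1 - b) powr (1 / s)) powr s"
  define f where "f = b powr s + (1 - b) powr s"
  have Rfg: "R p b = f * g" by (simp add: R_def f_def g_def s)
  have f0: "f \<ge> 0" "g \<ge> 0" by (simp_all add: f_def g_def)
  have ls: "ln s > 0" using s by simp
  have E0: "E > 0" by (simp add: E_def)
  have e: "(2 * ln s)\<^sup>2 / (8 * s) = (ln s)\<^sup>2 / (2 * s)" by (simp add: power2_eq_square)
  show ?thesis
  proof (cases "b \<ge> 1 / s\<^sup>2")
    case True
    have "ln (1 / s\<^sup>2) \<le> ln b" using True s b by (subst ln_le_cancel_iff) auto
    then have lb: "- ln b \<le> 2 * ln s" using s by (simp add: ln_div ln_realpow)
    moreover have "ln b \<le> ln (1 - b)" "ln (1 - b) \<le> 0" using b by auto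
    ultimately have "(ln (1 - b) - ln b)\<^sup>2 \<le> (2 * ln s)\<^sup>2" by (intro power_mono) auto
    then have "(ln (1 - b) - ln b)\<^sup>2 / (8 * s) \<le> (2 * ln s)\<^sup>2 / (8 * s)"
      using s by (intro divide_right_mono) auto
    then have e2: "exp ((ln (1 - b) - ln b)\<^sup>2 / (8 * s)) \<le> E" by (simp only: e E_def exp_le_cancel_iff)
    have "g \<le> 2 powr s * sqrt (b * (1 - b)) * exp ((ln (1 - b) - ln b)\<^sup>2 / (8 * s))"
      unfolding g_def using b s by (intro powr_sum_le_geometric_mean) auto
    also have "\<dots> \<le> 2 powr s * sqrt (b * (1 - b)) * E"
      using e2 b by (intro mult_left_mono) auto
    finally have g: "g \<le> 2 powr s * sqrt (b * (1 - b)) * E" .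
    have 1: "b powr s * sqrt (b * (1 - b)) \<le> 2 powr (- s)"
    proof -
      have "b powr s \<le> (1/2) powr s" using b s by (intro powr_mono2) auto
      also have "\<dots> = 2 powr (- s)" by (simp add: powr_minus_divide powr_divide)
      finally have "b powr s \<le> 2 powr (- s)" .
      moreover have "sqrt (b * (1 - b)) \<le> 1" using b by (simp add: mult_le_one)
      ultimately show ?thesis using mult_mono[of "b powr s" "2 powr (- s)" "sqrt (b * (1 - b))" 1] b by simp
    qed
    have 2: "(1 - b) powr s * sqrt (b * (1 - b)) \<le> 1 / sqrt (2 * exp 1 * s)"
    proof -
      have "(1 - b) powr s = exp (s * ln (1 - b))" using b by (simp add: powr_def)
      also have "\<dots> \<le> exp (- (s * b))"
        using ln_le_minus_one[of "1 - b"] b s mult_left_mono[of "ln (1 - b)" "- b" s] by simp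
      finally have x1: "(1 - b) powr s \<le> exp (- (s * b))" .
      \<comment> \<open>The maximum of sqrt(b) e^(-sb), squared: equality holds at b = 1/(2s), the
        origin of the constant 1/sqrt(2es).\<close>
      have "2 * s * b \<le> exp (2 * s * b - 1)" using exp_ge_add_one_self[of "2 * s * b - 1"] by simp
      then have "b \<le> exp (2 * s * b - 1) / (2 * s)" using s(2) by (simp add: pos_le_divide_eq mult_ac)
      also have "\<dots> = (exp (s * b))\<^sup>2 / (2 * exp 1 * s)"
        by (simp add: exp_diff mult_ac flip: exp_double)
      finally have "sqrt b \<le> sqrt ((exp (s * b))\<^sup>2 / (2 * exp 1 * s))" by simp
      also have "\<dots> = exp (s * b) / sqrt (2 * exp 1 * s)" by (simp add: real_sqrt_divide)
      finally have x2: "sqrt b \<le> exp (s * b) / sqrt (2 * exp 1 * s)" .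
      have "sqrt (b * (1 - b)) \<le> sqrt b" using b by (simp add: mult_left_le)
      then have x3: "sqrt (b * (1 - b)) \<le> exp (s * b) / sqrt (2 * exp 1 * s)" using x2 by (rule order_trans)
      have "(1 - b) powr s * sqrt (b * (1 - b)) \<le> exp (- (s * b)) * (exp (s * b) / sqrt (2 * exp 1 * s))"
        using x1 x3 b by (intro mult_mono) auto
      also have "\<dots> = 1 / sqrt (2 * exp 1 * s)" by (simp add: exp_minus)
      finally show ?thesis .
    qed
    have "R p b \<le> f * (2 powr s * sqrt (b * (1 - b)) * E)"
      unfolding Rfg using g f0 by (intro mult_left_mono) auto
    also have "\<dots> = 2 powr s * E * (f * sqrt (b * (1 - b)))" by (simp only: mult_ac)
    also have "\<dots> \<le> 2 powr s * E * (1 / sqrt (2 * exp 1 * s) + 2 powr (- s))"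
    proof (rule mult_left_mono)
      show "f * sqrt (b * (1 - b)) \<le> 1 / sqrt (2 * exp 1 * s) + 2 powr (- s)"
        using 1 2 by (simp only: f_def distrib_right)
    qed (use E0 in simp)
    finally show ?thesis by (simp only: E_def mult_ac)
  next
    case False
    have d: "1 / s\<^sup>2 > 0" using s by simp
    \<comment> \<open>The second factor is enlarged by moving b up to 1/s^2 and 1 - b up to 1; the
      geometric mean bound then applies at these fixed points.\<close>
    have "b powr (1 / s) \<le> (1 / s\<^sup>2) powr (1 / s)" using False b s by (intro powr_mono2) auto
    moreover have "(1 - b) powr (1 / s) \<le> 1 powr (1 / s)" using b s by (intro powr_mono2) auto
    ultimately have "g \<le> ((1 / s\<^sup>2) powr (1 / s) + 1 powr (1 / s)) powr s"
      unfolding g_def using s(2) by (intro powr_mono2[of s] add_mono add_nonneg_nonneg) auto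
    also have "\<dots> \<le> 2 powr s * sqrt (1 / s\<^sup>2 * 1) * exp ((ln 1 - ln (1 / s\<^sup>2))\<^sup>2 / (8 * s))"
      using d s by (intro powr_sum_le_geometric_mean) auto
    also have "sqrt (1 / s\<^sup>2 * 1) = 1 / s" using s by (simp add: real_sqrt_divide)
    also have "ln 1 - ln (1 / s\<^sup>2) = 2 * ln s" using s by (simp add: ln_div ln_realpow)
    finally have g: "g \<le> 2 powr s * (1 / s) * E" by (simp only: e E_def)
    have "f \<le> 1"
    proof -
      have "b powr s \<le> b powr 1" "(1 - b) powr s \<le> (1 - b) powr 1"
        using b s by (intro powr_mono'; simp)+
      then show ?thesis using b by (simp add: f_def)
    qed
    then have "R p b \<le> g" unfolding Rfg using f0 by (simp add: mult_left_le_one_le)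
    also note g
    also have "2 powr s * (1 / s) * E \<le> 2 powr s * (1 / sqrt (2 * exp 1 * s) + 2 powr (- s)) * E"
    proof (intro mult_right_mono mult_left_mono)
      \<comment> \<open>This is where s >= 6 enters, through e <= 3.\<close>
      have "2 * exp 1 * s \<le> s * s" using s exp_le by (intro mult_right_mono) auto
      then have "sqrt (2 * exp 1 * s) \<le> s" using s real_sqrt_le_mono[of "2 * exp 1 * s" "s * s"] by simp
      then have "1 / s \<le> 1 / sqrt (2 * exp 1 * s)" using s by (intro divide_left_mono mult_pos_pos) auto
      then show "1 / s \<le> 1 / sqrt (2 * exp 1 * s) + 2 powr (- s)" by (simp add: add_increasing2)
    qed (use E0 in auto)
    finally show ?thesis by (simp only: E_def)
  qed
qed

text \<open>The lower bound is \<open>R\<close> at 1/(2(p - 1)), where sqrt(b) e^(-sb) peaks. For s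
  = p - 1 the main term 2^s/sqrt(2es) equals 2^p/sqrt(8es). The limits arrive as unevaluated
  products, which separate equations identify as 1.\<close>

lemma Cr_asymp: "((\<lambda>p. Cr p / (2 powr p / sqrt (8 * exp 1 * p))) \<longlongrightarrow> 1) at_top"
proof (rule tendsto_sandwich)
  let ?D = "\<lambda>p::real. 2 powr p / sqrt (8 * exp 1 * p)"
  have "((\<lambda>p. ((1 / (2 * (p - 1))) powr (p - 1) + (1 - 1 / (2 * (p - 1))) powr (p - 1)) *
      ((1 / (2 * (p - 1))) powr (1 / (p - 1)) + (1 - 1 / (2 * (p - 1))) powr (1 / (p - 1))) powr (p - 1)
      / (2 powr p / sqrt (8 * exp 1 * p))) \<longlongrightarrow>
      exp (- (1 / 2)) * (inverse (exp (ln 2 - ln (1 / 2) / 2)) * (8 * exp 1) powr (1 / 2))) at_top"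
    by real_asymp
  moreover have "exp (- (1 / 2)) * (inverse (exp (ln 2 - ln (1 / 2) / 2)) * (8 * exp 1) powr (1 / 2)) = (1::real)"
  proof -
    have "ln (8 * exp 1) = 3 * ln 2 + (1::real)" using ln_realpow[of 2 3] by (simp add: ln_mult_pos)
    then show ?thesis by (simp add: powr_def ln_div flip: exp_add exp_minus) argo
  qed
  ultimately show "((\<lambda>p. ((1 / (2 * (p - 1))) powr (p - 1) + (1 - 1 / (2 * (p - 1))) powr (p - 1)) *
      ((1 / (2 * (p - 1))) powr (1 / (p - 1)) + (1 - 1 / (2 * (p - 1))) powr (1 / (p - 1))) powr (p - 1)
      / (2 powr p / sqrt (8 * exp 1 * p))) \<longlongrightarrow> 1) at_top"
    by simp
  have "((\<lambda>p. 2 powr (p - 1) * (1 / sqrt (2 * exp 1 * (p - 1)) + 2 powr (- (p - 1))) * exp ((ln (p - 1))\<^sup>2 / (2 * (p - 1)))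
      / (2 powr p / sqrt (8 * exp 1 * p))) \<longlongrightarrow>
      inverse ((2 * exp 1) powr (1 / 2)) * (8 * exp 1) powr (1 / 2) / 2) at_top"
    by real_asymp
  moreover have "inverse ((2 * exp 1) powr (1 / 2)) * (8 * exp 1) powr (1 / 2) / 2 = (1::real)"
    using real_sqrt_mult[of 4 "2 * exp 1"] by (simp add: powr_half_sqrt)
  ultimately show "((\<lambda>p. 2 powr (p - 1) * (1 / sqrt (2 * exp 1 * (p - 1)) + 2 powr (- (p - 1))) * exp ((ln (p - 1))\<^sup>2 / (2 * (p - 1)))
      / (2 powr p / sqrt (8 * exp 1 * p))) \<longlongrightarrow> 1) at_top"
    by simp
  show "\<forall>\<^sub>F p in at_top. ((1 / (2 * (p - 1))) powr (p - 1) + (1 - 1 / (2 * (p - 1))) powr (p - 1)) *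
      ((1 / (2 * (p - 1))) powr (1 / (p - 1)) + (1 - 1 / (2 * (p - 1))) powr (1 / (p - 1))) powr (p - 1) / ?D p
      \<le> Cr p / ?D p"
    using eventually_gt_at_top[of 2]
  proof eventually_elim
    case (elim p)
    have "R p (1 / (2 * (p - 1))) \<le> Cr p" using elim by (intro R_le_Cr) auto
    then show ?case unfolding R_def using elim by (intro divide_right_mono) auto
  qed
  show "\<forall>\<^sub>F p in at_top. Cr p / ?D p \<le> 2 powr (p - 1) * (1 / sqrt (2 * exp 1 * (p - 1)) + 2 powr (- (p - 1)))
      * exp ((ln (p - 1))\<^sup>2 / (2 * (p - 1))) / ?D p"
    using eventually_gt_at_top[of 7]
  proof eventually_elim
    case (elim p)
    have "Cr p \<le> 2 powr (p - 1) * (1 / sqrt (2 * exp 1 * (p - 1)) + 2 powr (- (p - 1))) * exp ((ln (p - 1))\<^sup>2 / (2 * (p - 1)))"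
      using elim R_upper_bound[of "p - 1" p "bmax p"] bmax_bounds[of p] by (simp only: Cr_eq)
    then show ?case using elim by (intro divide_right_mono) auto
  qed
qed

lemma Cr_at_top: "filterlim Cr at_top at_top"
proof -
  have D: "filterlim (\<lambda>p::real. 2 powr p / sqrt (8 * exp 1 * p)) at_top at_top" by real_asymp
  have "filterlim (\<lambda>p. Cr p / (2 powr p / sqrt (8 * exp 1 * p)) * (2 powr p / sqrt (8 * exp 1 * p))) at_top at_top"
    by (rule filterlim_tendsto_pos_mult_at_top[OF Cr_asymp _ D]) simp
  moreover have "\<forall>\<^sub>F p in at_top. Cr p / (2 powr p / sqrt (8 * exp 1 * p)) * (2 powr p / sqrt (8 * exp 1 * p)) = Cr p"
    using eventually_gt_at_top[of 1] by eventually_elim simp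
  ultimately show ?thesis by (rule filterlim_mono_eventually[OF _ order_refl order_refl])
qed

text \<open>C_p = C_q^(1/(q-1)) with q = p/(p - 1) tending to infinity. The root removes the factor
  sqrt(8eq) and the ratio tending to 1, and 2^(q/(q-1)) tends to 2.\<close>

lemma Cr_at_right_1: "(Cr \<longlongrightarrow> 2) (at_right 1)"
proof -
  let ?D = "\<lambda>p::real. 2 powr p / sqrt (8 * exp 1 * p)"
  have 1: "((\<lambda>q. ln (Cr q / ?D q) / (q - 1)) \<longlongrightarrow> 0) at_top"
  proof (rule tendsto_divide_0[OF tendsto_ln[OF Cr_asymp]])
    show "filterlim (\<lambda>q::real. q - 1) at_infinity at_top"
      by (rule filterlim_at_top_imp_at_infinity) real_asymp
  qed simp
  have 2: "((\<lambda>q. ln (?D q) / (q - 1)) \<longlongrightarrow> ln 2) at_top" by real_asymp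
  have "((\<lambda>q. exp (ln (Cr q / ?D q) / (q - 1) + ln (?D q) / (q - 1))) \<longlongrightarrow> exp (0 + ln 2)) at_top"
    by (intro tendsto_intros 1 2)
  then have 3: "((\<lambda>q. exp (ln (Cr q / ?D q) / (q - 1) + ln (?D q) / (q - 1))) \<longlongrightarrow> 2) at_top" by simp
  have 4: "\<forall>\<^sub>F q in at_top. exp (ln (Cr q / ?D q) / (q - 1) + ln (?D q) / (q - 1)) = Cr q powr (1 / (q - 1))"
    using eventually_gt_at_top[of 1]
  proof eventually_elim
    case (elim q)
    have C: "Cr q > 0" using Cr_ge_1[OF elim] by simp
    have D: "?D q > 0" using elim by simp
    have "ln (x / y) + ln y = ln x" if "x > 0" "y > 0" for x y :: real using that by (simp add: ln_div)
    from this[OF C D] have "ln (Cr q / ?D q) + ln (?D q) = ln (Cr q)" .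
    then show ?case using C by (simp only: powr_def flip: add_divide_distrib) simp
  qed
  have 5: "((\<lambda>q. Cr q powr (1 / (q - 1))) \<longlongrightarrow> 2) at_top"
    by (rule Lim_transform_eventually[OF 3 4])
  have "filterlim (\<lambda>p::real. p / (p - 1)) at_top (at_right 1)" by real_asymp
  from filterlim_compose[OF 5 this]
  have 6: "((\<lambda>p. Cr (p / (p - 1)) powr (1 / (p / (p - 1) - 1))) \<longlongrightarrow> 2) (at_right 1)" .
  have "\<forall>\<^sub>F p in at_right 1. Cr (p / (p - 1)) powr (1 / (p / (p - 1) - 1)) = Cr p"
    using eventually_at_right_less[of "1::real"]
  proof eventually_elim
    case (elim p)
    have "(p / (p - 1) - 1) * (p - 1) = 1" "p / (p - 1) > 1" using elim by (simp_all add: field_simps)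
    then show ?case using Cr_conjugate[of "p / (p - 1)" p] elim by simp
  qed
  then show ?thesis by (rule Lim_transform_eventually[OF 6])
qed

section \<open>Algebraicity and the case p = 3\<close>

text \<open>The critical equation \<open>R_num = 0\<close> is homogeneous in \<open>(b, 1 - b)\<close>, so for \<open>p - 1 = m / n\<close> it
  becomes a polynomial equation for \<open>(b / (1 - b))\<^bsup>1 / (m n)\<^esup>\<close>.\<close>
lemma algebraic_bp:
  assumes p: "p > 1" "p \<noteq> 2" "p \<in> \<rat>"
  shows "algebraic (bp p)"
proof -
  define s where "s = p - 1"
  have s: "s > 0" "s \<in> \<rat>" using p by (simp_all add: s_def)
  obtain m n :: nat where mn: "n \<noteq> 0" "\<bar>s\<bar> = real m / real n"
    using Rats_abs_nat_div_natE[OF s(2)] by metis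
  have sm: "s = real m / real n" using mn s by simp
  have m0: "m \<noteq> 0" using sm s by (intro notI) simp
  define P :: "real poly" where "P = Polynomial.smult (real m) ((monom 1 (m^2) - monom 1 (m*n)) * (monom 1 (n^2) + 1)) +
    Polynomial.smult (real n) ((monom 1 (n^2) - monom 1 (m*n)) * (monom 1 (m^2) + 1))"
  define w where "w = (\<lambda>b::real. (b / (1 - b)) powr (1 / (real m * real n)))"
  have Pw: "n * R_num s b = (1 - b) powr s * (1 - b) powr (1 / s) * (1 - b) * poly P (w b)" if b: "0 < b" "b < 1" for b
  proof -
    define v where "v = 1 - b"
    define r where "r = b / v"
    have v: "v > 0" "r > 0" "b = r * v" using b by (simp_all add: v_def r_def)
    have pw: "w b ^ k = r powr (real k / (real m * real n))" for k
      using v(2) b by (simp add: w_def r_def v_def powr_powr flip: powr_realpow)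
    \<comment> \<open>For s = m/n and r = b/(1 - b), the common root of order mn makes r^s, r^(1/s)
      and r integer powers of \<open>w b\<close>.\<close>
    have e1: "w b ^ (m^2) = r powr s" "w b ^ (n^2) = r powr (1 / s)" "w b ^ (m*n) = r"
      unfolding pw using m0 mn v(2) by (simp_all add: sm power2_eq_square)
    have e2: "b powr x = r powr x * v powr x" for x unfolding v(3) using v(1,2) by (simp add: powr_mult)
    have ns: "real n * s = real m" using mn by (simp add: sm)
    have "n * R_num s b = (real n * s) * (r powr s * v powr s * v - v powr s * (r * v)) * (r powr (1/s) * v powr (1/s) + v powr (1/s))
      + n * (r powr (1/s) * v powr (1/s) * v - v powr (1/s) * (r * v)) * (r powr s * v powr s + v powr s)"
      unfolding R_num_def e2 v_def[symmetric] unfolding v(3)[symmetric] by (simp add: algebra_simps)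
    also have "\<dots> = v powr s * v powr (1 / s) * v * poly P (w b)"
      unfolding ns by (simp add: P_def poly_monom e1 algebra_simps)
    finally show ?thesis by (simp add: v_def)
  qed
  have b: "0 < bp p" "bp p < 1" using bp_pos[OF p(1,2)] bp_less_half[OF p(1,2)] by auto
  have root: "poly P (w (bp p)) = 0" using Pw[OF b] R_num_bp[OF p(1,2)] b by (simp add: s_def)
  \<comment> \<open>A root proves nothing for the zero polynomial; a non-root to the left of b_p
    excludes it.\<close>
  have "R_num s (bp p / 2) \<noteq> 0" unfolding s_def using b by (intro R_num_less_bp p) auto
  then have "poly P (w (bp p / 2)) \<noteq> 0" using Pw[of "bp p / 2"] b mn by auto
  then have "P \<noteq> 0" by auto
  moreover have "coeff P i \<in> \<rat>" for i
  proof -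
    have one: "coeff (1 :: real poly) j \<in> \<rat>" for j by (cases j) auto
    have mul: "coeff (A * B) j \<in> \<rat>" if "\<And>i. coeff A i \<in> \<rat>" "\<And>i. coeff B i \<in> \<rat>" for A B :: "real poly" and j
      using that by (auto simp: coeff_mult intro!: Rats_sum Rats_mult)
    show ?thesis unfolding P_def coeff_add coeff_smult
      by (intro Rats_add Rats_mult mul) (auto simp: one intro!: Rats_add Rats_diff)
  qed
  ultimately have "algebraic (w (bp p))" using root by (intro algebraicI'[of P])
  then have "algebraic (w (bp p) ^ (m * n))" by auto
  also have "w (bp p) ^ (m * n) = bp p / (1 - bp p)"
    using b m0 mn by (simp add: w_def powr_powr flip: powr_realpow)
  finally have r: "algebraic (bp p / (1 - bp p))" .
  have "bp p = (bp p / (1 - bp p)) / (1 + bp p / (1 - bp p))" using b by (simp add: field_simps)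
  moreover have "algebraic (1::real)" by (intro rat_imp_algebraic) auto
  ultimately show ?thesis using r by (metis algebraic_real_add algebraic_real_divide)
qed

lemma algebraic_one_real: "algebraic (1::real)"
  by (intro rat_imp_algebraic) auto

lemma algebraic_powr_sum:
  fixes b x :: real
  assumes "algebraic b" "0 < b" "b < 1" "x \<in> \<rat>" "x > 0"
  shows "algebraic (b powr x + (1 - b) powr x)"
  using assms algebraic_one_real by (intro algebraic_real_add algebraic_powr_rat algebraic_real_diff) auto

lemma algebraic_R:
  assumes "p > 1" "p \<in> \<rat>" "algebraic b" "0 < b" "b < 1"
  shows "algebraic (R p b)"
  unfolding R_def using assms
  by (intro algebraic_real_mult algebraic_powr_sum algebraic_powr_rat powr_sum_pos) auto

lemma algebraic_tb:
  assumes "p > 1" "p \<in> \<rat>" "algebraic b" "0 < b" "b < 1"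
  shows "algebraic (tb p b)"
  unfolding tb_def using assms
  by (intro algebraic_real_diff algebraic_real_divide algebraic_powr_sum algebraic_powr_rat) auto

lemma algebraic_Cr:
  assumes "p > 1" "p \<in> \<rat>"
  shows "algebraic (Cr p)"
proof (cases "p = 2")
  case True
  then show ?thesis by (simp add: Cr_2 algebraic_one_real)
next
  case False
  then show ?thesis
    using assms bp_pos[of p] bp_less_half[of p] algebraic_bp[of p]
    by (simp add: Cr_eq bmax_def algebraic_R)
qed

text \<open>At p = 3 \<open>R\<close> depends on b only through y = sqrt(b(1 - b)), as the cubic (1
  - 2y^2)(1 + 2y).\<close>

lemma R_3:
  assumes "0 \<le> b" "b \<le> 1"
  shows "R 3 b = (1 - 2 * (sqrt (b * (1 - b)))\<^sup>2) * (1 + 2 * sqrt (b * (1 - b)))"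
proof -
  have "b powr 2 = b\<^sup>2" "(1 - b) powr 2 = (1 - b)\<^sup>2"
    using assms by (simp_all add: powr_numeral)
  moreover have "(b powr (1/2) + (1 - b) powr (1/2)) powr 2 = (sqrt b + sqrt (1 - b))\<^sup>2"
    using assms by (simp add: powr_half_sqrt powr_numeral)
  moreover have "(sqrt b + sqrt (1 - b))\<^sup>2 = 1 + 2 * sqrt (b * (1 - b))"
    using assms by (simp add: power2_sum real_sqrt_mult)
  moreover have "b\<^sup>2 + (1 - b)\<^sup>2 = 1 - 2 * (sqrt (b * (1 - b)))\<^sup>2"
  proof -
    have "(sqrt (b * (1 - b)))\<^sup>2 = b * (1 - b)" using assms by simp
    then show ?thesis by (simp add: power2_eq_square algebra_simps)
  qed
  ultimately show ?thesis by (simp add: R_def)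
qed

lemma sqrt7_bounds: "2 < sqrt 7" "sqrt 7 < 3"
  by (simp_all add: real_less_rsqrt real_less_lsqrt)

lemma bp_3: "bp 3 = 1/2 - sqrt (1 + 2 * sqrt 7) / 6"
  and sqrt_bp_3: "sqrt (bp 3 * (1 - bp 3)) = (sqrt 7 - 1) / 6"
proof -
  define b where "b = 1/2 - sqrt (1 + 2 * sqrt 7) / 6"
  define y where "y = (sqrt 7 - 1) / 6"
  have y0: "y > 0" using sqrt7_bounds by (simp add: y_def)
  \<comment> \<open>The critical equation of the cubic; \<open>b\<close> is the smaller solution of
    b(1 - b) = y^2.\<close>
  have yq: "6 * y\<^sup>2 + 2 * y = 1" by (simp add: y_def power2_eq_square field_simps)
  have "sqrt (1 + 2 * sqrt 7) \<le> sqrt 9" using sqrt7_bounds by (intro real_sqrt_le_mono) simp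
  then have b: "0 \<le> b" "b \<le> 1/2" using sqrt7_bounds by (simp_all add: b_def)
  have "b * (1 - b) = 1/4 - (sqrt (1 + 2 * sqrt 7))\<^sup>2 / 36" by (simp add: b_def power2_eq_square field_simps)
  also have "\<dots> = y\<^sup>2" using sqrt7_bounds by (simp add: y_def power2_eq_square field_simps)
  finally have bb: "b * (1 - b) = y\<^sup>2" .
  then have sb: "sqrt (b * (1 - b)) = y" using y0 by simp
  have max: "R 3 b' \<le> R 3 b" if "b' \<in> {0..1/2}" for b'
  proof -
    define x where "x = sqrt (b' * (1 - b'))"
    have x: "x \<ge> 0" using that by (simp add: x_def)
    have "(1 - 2 * y\<^sup>2) * (1 + 2 * y) - (1 - 2 * x\<^sup>2) * (1 + 2 * x) = (x - y)\<^sup>2 * (4 * x + 8 * y + 2)"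
      using yq by algebra
    moreover have "(x - y)\<^sup>2 * (4 * x + 8 * y + 2) \<ge> 0" using x y0 by simp
    ultimately show ?thesis using that b by (simp add: R_3 sb x_def)
  qed
  have "b = bp 3" by (rule bp_unique) (use b max in auto)
  then show "bp 3 = 1/2 - sqrt (1 + 2 * sqrt 7) / 6" "sqrt (bp 3 * (1 - bp 3)) = (sqrt 7 - 1) / 6"
    using sb by (simp_all add: b_def y_def)
qed

lemma Cr_3: "Cr 3 = (17 + 7 * sqrt 7) / 27"
proof -
  have "Cr 3 = R 3 (bp 3)" by (simp add: Cr_eq bmax_def)
  also have "\<dots> = (1 - 2 * ((sqrt 7 - 1) / 6)\<^sup>2) * (1 + 2 * ((sqrt 7 - 1) / 6))"
    using bp_pos[of 3] bp_less_half[of 3] by (subst R_3) (simp_all add: sqrt_bp_3)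
  also have "\<dots> = (17 + 7 * sqrt 7) / 27" by (simp add: power2_eq_square field_simps)
  finally show ?thesis .
qed

lemma tb_3: "tb 3 (bp 3) = - (1/3) * sqrt ((13 * sqrt 7 - 34) / 2)"
proof -
  define b where "b = bp 3"
  define y where "y = sqrt (b * (1 - b))"
  have y: "y = (sqrt 7 - 1) / 6" by (simp add: y_def b_def sqrt_bp_3)
  have b: "0 < b" "b < 1/2" using bp_pos[of 3] bp_less_half[of 3] by (simp_all add: b_def)
  have y0: "y > 0" using b by (simp add: y_def)
  have yy: "y = sqrt b * sqrt (1 - b)" by (simp add: y_def real_sqrt_mult)
  have sp: "sqrt b + sqrt (1 - b) > 0" using b by (intro add_pos_pos) auto
  \<comment> \<open>Expand the fraction by sqrt b + sqrt(1 - b), whose square is 1 + 2y.\<close>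
  have "sqrt b / (sqrt b + sqrt (1 - b)) = (b + y) / (1 + 2 * y)"
  proof -
    have "sqrt b * (1 + 2 * y) = (b + y) * (sqrt b + sqrt (1 - b))"
    proof -
      have "x * (1 + 2 * (x * z)) = (x\<^sup>2 + x * z) * (x + z)" if "x\<^sup>2 + z\<^sup>2 = 1" for x z :: real
        using that by algebra
      from this[of "sqrt b" "sqrt (1 - b)"] show ?thesis unfolding yy using b by simp
    qed
    then show ?thesis using sp y0 by (simp add: frac_eq_eq)
  qed
  then have "tb 3 b = b - (b + y) / (1 + 2 * y)" using b by (simp add: tb_def powr_half_sqrt)
  also have "\<dots> = - (y * (1 - 2 * b) / (1 + 2 * y))" using y0 by (simp add: field_simps)
  finally have t: "tb 3 b = - (y * (1 - 2 * b) / (1 + 2 * y))" .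
  have "y * (1 - 2 * b) / (1 + 2 * y) = (1/3) * sqrt ((13 * sqrt 7 - 34) / 2)"
  proof -
    have "0 \<le> 3 * (y * (1 - 2 * b) / (1 + 2 * y))" using y0 b by simp
    moreover have "(3 * (y * (1 - 2 * b) / (1 + 2 * y)))\<^sup>2 = (13 * sqrt 7 - 34) / 2"
    proof -
      have "(1 - 2 * b)\<^sup>2 = (1 + 2 * sqrt 7) / 9"
        using sqrt7_bounds by (simp add: b_def bp_3 power_divide)
      then have "(3 * (y * (1 - 2 * b) / (1 + 2 * y)))\<^sup>2 = y\<^sup>2 * (1 + 2 * sqrt 7) / (1 + 2 * y)\<^sup>2"
        by (simp add: power_mult_distrib power_divide)
      also have "y\<^sup>2 * (1 + 2 * sqrt 7) / (1 + 2 * y)\<^sup>2 = (13 * sqrt 7 - 34) / 2"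
      proof -
        have y1: "1 + 2 * y = (2 + sqrt 7) / 3" by (simp add: y field_simps)
        have "(2 + sqrt 7)\<^sup>2 \<noteq> 0" using sqrt7_bounds by auto
        moreover have "2 * ((sqrt 7 - 1)\<^sup>2 * (1 + 2 * sqrt 7)) = 4 * ((13 * sqrt 7 - 34) * (2 + sqrt 7)\<^sup>2)"
          by (simp add: power2_eq_square algebra_simps)
        ultimately show ?thesis unfolding y1 by (simp add: y power_divide divide_simps)
      qed
      finally show ?thesis .
    qed
    ultimately have "3 * (y * (1 - 2 * b) / (1 + 2 * y)) = sqrt ((13 * sqrt 7 - 34) / 2)"
      by (metis real_sqrt_unique)
    then show ?thesis by linarith
  qed
  then show ?thesis using t by (simp add: b_def)
qed

section \<open>Conjugate exponents and the final assembly\<close>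

lemma conjugate_exponent:
  assumes "p > 1" "1 / p + 1 / q = (1::real)"
  shows "q > 1" "(p - 1) * (q - 1) = 1"
proof -
  \<comment> \<open>Since 1/0 = 0, the value q = 0 would leave 1/p = 1, against p > 1.\<close>
  have q0: "q \<noteq> 0" using assms by auto
  then have *: "p + q = p * q" using assms by (simp add: field_simps)
  then show "(p - 1) * (q - 1) = 1" by (simp add: algebra_simps)
  then have "q - 1 > 0" using assms by (metis diff_gt_0_iff_gt zero_less_mult_pos zero_less_one)
  then show "q > 1" by simp
qed

lemma Cr_conjugate_powr:
  assumes "p > 1" "q > 1" "(p - 1) * (q - 1) = 1"
  shows "Cr p powr (1 / sqrt (p - 1)) = Cr q powr (1 / sqrt (q - 1))"
proof -
  have q: "q - 1 = 1 / (p - 1)" using assms by (simp add: field_simps)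
  have "1 / (p - 1) * (1 / sqrt (q - 1)) = 1 / sqrt (p - 1)"
  proof -
    have "sqrt (p - 1) * sqrt (p - 1) = p - 1" "sqrt (p - 1) > 0" using assms by auto
    then show ?thesis unfolding q by (simp add: real_sqrt_divide field_simps)
  qed
  then show ?thesis
    using Cr_conjugate[OF assms] by (simp only: powr_powr)
qed

lemma Cp_eq_SUP:
  assumes "p > 1"
  shows "Cp p = (SUP b\<in>{0..1}. ennreal (R p b))"
  unfolding Cp_eq[OF assms]
proof (rule antisym)
  have "bmax p \<in> {0..1}" using bmax_bounds[OF assms] by auto
  then show "ennreal (R p (bmax p)) \<le> (SUP b\<in>{0..1}. ennreal (R p b))" by (rule SUP_upper)
  show "(SUP b\<in>{0..1}. ennreal (R p b)) \<le> ennreal (R p (bmax p))"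
    by (intro SUP_least ennreal_leI R_le_bmax assms)
qed

theorem theorem2p3:
  shows
  \<comment> \<open>facts about b_p used in its definition\<close>
  "(\<forall>p>1. p \<noteq> 2 \<longrightarrow>
      bp p \<in> {0<..<1/2} \<and>
      (\<exists>!b. b \<in> {0..1/2} \<and> (\<forall>b'\<in>{0..1/2}. R p b' \<le> R p b)) \<and>
      (\<forall>b\<in>{0<..<bp p}. \<exists>D. (R p has_real_derivative D) (at b) \<and> D > 0) \<and>
      (\<forall>b\<in>{bp p<..<1/2}. \<exists>D. (R p has_real_derivative D) (at b) \<and> D < 0))
   \<and>
  \<comment> \<open>(i)\<close>
   (\<forall>p>1. Cp p = (SUP b\<in>{0..1}. ennreal (R p b)) \<and>
      (\<exists>b\<in>{0<..<1/2}. (\<forall>b'\<in>{0<..<1/2}. R p b' \<le> R p b) \<and> Cp p = ennreal (R p b)) \<and>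
      (p \<noteq> 2 \<longrightarrow> Cp p = ennreal (R p (bp p))))
   \<and> Cp 2 = 1 \<and> (\<forall>b\<in>{0..1}. R 2 b = 1)
   \<and> (\<forall>p>1. \<forall>(M::'a measure) (X::'a \<Rightarrow> real).
        prob_space M \<and> X \<in> borel_measurable M \<and> integrable M X \<longrightarrow>
        (\<integral>\<^sup>+x. ennreal (\<bar>X x - (\<integral>y. X y \<partial>M)\<bar> powr p) \<partial>M)
          \<le> Cp p * (\<integral>\<^sup>+x. ennreal (\<bar>X x\<bar> powr p) \<partial>M))
   \<and>
  \<comment> \<open>(ii)\<close>
   (\<forall>p>1. \<forall>(M::'a measure) (X::'a \<Rightarrow> real).
        prob_space M \<and> X \<in> borel_measurable M \<and> integrable M X \<longrightarrow>
        ((\<integral>\<^sup>+x. ennreal (\<bar>X x - (\<integral>y. X y \<partial>M)\<bar> powr p) \<partial>M)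
            = Cp p * (\<integral>\<^sup>+x. ennreal (\<bar>X x\<bar> powr p) \<partial>M)
         \<longleftrightarrow>
         (\<integral>\<^sup>+x. ennreal (\<bar>X x\<bar> powr p) \<partial>M) = \<infinity>
         \<or> (p = 2 \<and> (\<integral>\<^sup>+x. ennreal ((X x)\<^sup>2) \<partial>M) < \<infinity> \<and> (\<integral>y. X y \<partial>M) = 0)
         \<or> (p \<noteq> 2 \<and> (\<exists>c::real. distr M borel X =
               distr (measure_pmf (Xab (1 - bp p) (bp p))) borel
                 (\<lambda>x. c * (x - tb p (bp p)))))))
   \<and>
  \<comment> \<open>(iii)\<close>
   (\<forall>p>1. \<forall>q. 1 / p + 1 / q = 1 \<longrightarrow>
        Cr p powr (1 / sqrt (p - 1)) = Cr q powr (1 / sqrt (q - 1)) \<and>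
        (p \<noteq> 2 \<longrightarrow> bp p = bp q))
   \<and>
  \<comment> \<open>(iv)\<close>
   ((\<lambda>p. Cr p / (2 powr p / sqrt (8 * exp 1 * p))) \<longlongrightarrow> 1) at_top
   \<and>
  \<comment> \<open>(v)\<close>
   strictly_convex_on {1<..} (\<lambda>p. ln (Cr p))
   \<and> continuous_on {1<..} Cr
   \<and> (\<forall>x y. 1 < x \<and> x < y \<and> y \<le> 2 \<longrightarrow> Cr y < Cr x)
   \<and> (\<forall>x y. 2 \<le> x \<and> x < y \<longrightarrow> Cr x < Cr y)
   \<and> (Cr \<longlongrightarrow> 2) (at_right 1) \<and> Cr 2 = 1
   \<and> filterlim Cr at_top at_top
   \<and>
  \<comment> \<open>(vi)\<close>
   (\<forall>p>1. p \<in> \<rat> \<longrightarrow> algebraic (Cr p) \<and>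
        (p \<noteq> 2 \<longrightarrow> algebraic (bp p) \<and> algebraic (tb p (bp p))))
   \<and> Cr 3 = (17 + 7 * sqrt 7) / 27
   \<and> bp 3 = 1/2 - sqrt (1 + 2 * sqrt 7) / 6
   \<and> tb 3 (bp 3) = - (1/3) * sqrt ((13 * sqrt 7 - 34) / 2)"
proof (intro conjI)
  show "\<forall>p>1. p \<noteq> 2 \<longrightarrow>
      bp p \<in> {0<..<1/2} \<and>
      (\<exists>!b. b \<in> {0..1/2} \<and> (\<forall>b'\<in>{0..1/2}. R p b' \<le> R p b)) \<and>
      (\<forall>b\<in>{0<..<bp p}. \<exists>D. (R p has_real_derivative D) (at b) \<and> D > 0) \<and>
      (\<forall>b\<in>{bp p<..<1/2}. \<exists>D. (R p has_real_derivative D) (at b) \<and> D < 0)"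
  proof (intro allI impI conjI)
    fix p :: real assume p: "p > 1" "p \<noteq> 2"
    show b: "bp p \<in> {0<..<1/2}" using bp_pos[OF p] bp_less_half[OF p] by simp
    show "\<exists>!b. b \<in> {0..1/2} \<and> (\<forall>b'\<in>{0..1/2}. R p b' \<le> R p b)"
    proof (rule ex1I)
      show "bp p \<in> {0..1/2} \<and> (\<forall>b'\<in>{0..1/2}. R p b' \<le> R p (bp p))"
        using b R_le_bp[OF p] by auto
    qed (use bp_unique[OF p] in blast)
    show "\<forall>b\<in>{0<..<bp p}. \<exists>D. (R p has_real_derivative D) (at b) \<and> D > 0"
      using R_deriv_pos[OF p] by simp
    show "\<forall>b\<in>{bp p<..<1/2}. \<exists>D. (R p has_real_derivative D) (at b) \<and> D < 0"
      using R_deriv_neg[OF p] by simp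
  qed
  show "\<forall>p>1. Cp p = (SUP b\<in>{0..1}. ennreal (R p b)) \<and>
      (\<exists>b\<in>{0<..<1/2}. (\<forall>b'\<in>{0<..<1/2}. R p b' \<le> R p b) \<and> Cp p = ennreal (R p b)) \<and>
      (p \<noteq> 2 \<longrightarrow> Cp p = ennreal (R p (bp p)))"
  proof (intro allI impI conjI)
    fix p :: real assume p: "p > 1"
    show "Cp p = (SUP b\<in>{0..1}. ennreal (R p b))" by (rule Cp_eq_SUP[OF p])
    show "\<exists>b\<in>{0<..<1/2}. (\<forall>b'\<in>{0<..<1/2}. R p b' \<le> R p b) \<and> Cp p = ennreal (R p b)"
      using bmax_bounds[OF p] R_le_bmax[OF p] Cp_eq[OF p] by (intro bexI[of _ "bmax p"]) auto
    show "Cp p = ennreal (R p (bp p))" if "p \<noteq> 2" using that Cp_eq[OF p] by (simp add: bmax_def)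
  qed
  show "Cp 2 = 1" by (simp add: Cp_eq bmax_def R_2)
  show "\<forall>b\<in>{0..1}. R 2 b = 1" using R_2 by blast
  show "\<forall>p>1. \<forall>(M::'a measure) (X::'a \<Rightarrow> real).
        prob_space M \<and> X \<in> borel_measurable M \<and> integrable M X \<longrightarrow>
        (\<integral>\<^sup>+x. ennreal (\<bar>X x - (\<integral>y. X y \<partial>M)\<bar> powr p) \<partial>M)
          \<le> Cp p * (\<integral>\<^sup>+x. ennreal (\<bar>X x\<bar> powr p) \<partial>M)"
    by (simp add: Cp_eq recentering_inequality)
  show "\<forall>p>1. \<forall>(M::'a measure) (X::'a \<Rightarrow> real).
        prob_space M \<and> X \<in> borel_measurable M \<and> integrable M X \<longrightarrow>
        ((\<integral>\<^sup>+x. ennreal (\<bar>X x - (\<integral>y. X y \<partial>M)\<bar> powr p) \<partial>M)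
            = Cp p * (\<integral>\<^sup>+x. ennreal (\<bar>X x\<bar> powr p) \<partial>M)
         \<longleftrightarrow>
         (\<integral>\<^sup>+x. ennreal (\<bar>X x\<bar> powr p) \<partial>M) = \<infinity>
         \<or> (p = 2 \<and> (\<integral>\<^sup>+x. ennreal ((X x)\<^sup>2) \<partial>M) < \<infinity> \<and> (\<integral>y. X y \<partial>M) = 0)
         \<or> (p \<noteq> 2 \<and> (\<exists>c::real. distr M borel X =
               distr (measure_pmf (Xab (1 - bp p) (bp p))) borel
                 (\<lambda>x. c * (x - tb p (bp p))))))"
  proof (intro allI impI, elim conjE)
    fix p :: real and M :: "'a measure" and X :: "'a \<Rightarrow> real"
    assume p: "p > 1" and M: "prob_space M" and X: "X \<in> borel_measurable M" "integrable M X"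
    show "(\<integral>\<^sup>+x. ennreal (\<bar>X x - (\<integral>y. X y \<partial>M)\<bar> powr p) \<partial>M)
            = Cp p * (\<integral>\<^sup>+x. ennreal (\<bar>X x\<bar> powr p) \<partial>M)
         \<longleftrightarrow>
         (\<integral>\<^sup>+x. ennreal (\<bar>X x\<bar> powr p) \<partial>M) = \<infinity>
         \<or> (p = 2 \<and> (\<integral>\<^sup>+x. ennreal ((X x)\<^sup>2) \<partial>M) < \<infinity> \<and> (\<integral>y. X y \<partial>M) = 0)
         \<or> (p \<noteq> 2 \<and> (\<exists>c::real. distr M borel X =
               distr (measure_pmf (Xab (1 - bp p) (bp p))) borel
                 (\<lambda>x. c * (x - tb p (bp p)))))"
    proof (cases "p = 2")
      case True
      have C: "Cp 2 = 1" by (simp add: Cp_eq bmax_def R_2)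
      show ?thesis unfolding True C mult_1 recentering_equality_iff_2[OF M X] by blast
    next
      case False
      have C: "Cp p = ennreal (R p (bp p))" using False Cp_eq[OF p] by (simp add: bmax_def)
      show ?thesis unfolding C recentering_equality_iff[OF M X p False] using False by blast
    qed
  qed
  show "\<forall>p>1. \<forall>q. 1 / p + 1 / q = 1 \<longrightarrow>
        Cr p powr (1 / sqrt (p - 1)) = Cr q powr (1 / sqrt (q - 1)) \<and>
        (p \<noteq> 2 \<longrightarrow> bp p = bp q)"
    using conjugate_exponent Cr_conjugate_powr bp_conjugate by metis
  show "((\<lambda>p. Cr p / (2 powr p / sqrt (8 * exp 1 * p))) \<longlongrightarrow> 1) at_top"
    by (rule Cr_asymp)
  show "strictly_convex_on {1<..} (\<lambda>p. ln (Cr p))" by (rule ln_Cr_strictly_convex)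
  show "continuous_on {1<..} Cr" by (rule continuous_on_Cr)
  show "\<forall>x y. 1 < x \<and> x < y \<and> y \<le> 2 \<longrightarrow> Cr y < Cr x" using Cr_strict_antimono by blast
  show "\<forall>x y. 2 \<le> x \<and> x < y \<longrightarrow> Cr x < Cr y" using Cr_strict_mono by blast
  show "(Cr \<longlongrightarrow> 2) (at_right 1)" by (rule Cr_at_right_1)
  show "Cr 2 = 1" by (rule Cr_2)
  show "filterlim Cr at_top at_top" by (rule Cr_at_top)
  show "\<forall>p>1. p \<in> \<rat> \<longrightarrow> algebraic (Cr p) \<and>
        (p \<noteq> 2 \<longrightarrow> algebraic (bp p) \<and> algebraic (tb p (bp p)))"
  proof (intro allI impI conjI)
    fix p :: real assume p: "p > 1" "p \<in> \<rat>"
    show "algebraic (Cr p)" by (rule algebraic_Cr[OF p])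
    assume p2: "p \<noteq> 2"
    show a: "algebraic (bp p)" by (rule algebraic_bp[OF p(1) p2 p(2)])
    show "algebraic (tb p (bp p))"
      using bp_pos[OF p(1) p2] bp_less_half[OF p(1) p2] by (intro algebraic_tb p a) auto
  qed
  show "Cr 3 = (17 + 7 * sqrt 7) / 27" by (rule Cr_3)
  show "bp 3 = 1/2 - sqrt (1 + 2 * sqrt 7) / 6" by (rule bp_3)
  show "tb 3 (bp 3) = - (1/3) * sqrt ((13 * sqrt 7 - 34) / 2)" by (rule tb_3)
qed

end
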